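(* Let $c>0$ and $k\in(0,c/4)$, and let $u_0=u_0(\cdot;k,c)$ be the smooth solitary wave profile of the Degasperis–Procesi equation with speed $c$ and asymptotic end state $k$. For each $\lambda\in i\mathbb R\setminus\{0\}$ the squared eigenfunction connection provides three linearly independent solutions of the third-order ordinary differential equation $$\lambda(v-v'')=c(v-v'')'+3u_0'v''+3u_0''v'-4u_0v'-4u_0'v+u_0v'''+u_0'''v .$$ That is, there exist three linearly independent solutions $v_1,v_2,v_3$ of this equation on $\mathbb R$ such that, for each $j\in\{1,2,3\}$, there are $\sigma_j\in\mathbb C\setminus\{0\}$, a solution $\phi_j(\xi,t)$ of the Lax pair with parameter $\sigma_j$ and a solution $\psi_j(\xi,t)$ of the adjoint Lax pair with parameter $\sigma_j$ (both with potential $u_0$) satisfying $$e^{\lambda t}v_j(\xi)=\left(\phi_j\psi_j-\phi_{j,\xi}\psi_{j,\xi}\right)_\xi(\xi,t).$$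
   Context: The Degasperis–Procesi (DP) equation is $u_t-u_{txx}=3u_xu_{xx}-4uu_x+uu_{xxx}$. For each $c>0$ and $k\in(0,c/4)$ it is known that there is a smooth traveling wave $u(x,t)=u_0(x-ct)$, with non-constant even profile $u_0=u_0(\cdot;k,c)\in C^\infty(\mathbb R)$ satisfying $(c-u_0)^3(u_0-u_0'')=k(c-k)^3$, $u_0'(0)=0$, $u_0(\xi)\to k$ as $|\xi|\to\infty$, $0<u_0<c$ and $u_0-u_0''>0$ on $\mathbb R$. Write $m=u_0-u_0''$ and $\xi=x-ct$. For $\sigma\in\mathbb C\setminus\{0\}$, the Lax pair with potential $u_0$ is $$\phi_{\xi\xi\xi}=\phi_\xi+\sigma m\phi,\qquad \phi_t=\tfrac1\sigma\phi_{\xi\xi}+(c-u_0)\phi_\xi+u_0'\phi,$$ and the adjoint Lax pair is $$\psi_{\xi\xi\xi}=\psi_\xi-\sigma m\psi,\qquad \psi_t=-\tfrac1\sigma\psi_{\xi\xi}+(c-u_0)\psi_\xi+u_0'\psi.$$ The squared eigenfunction connection is the map $(\phi,\psi)\mapsto(\phi\psi-\phi_\xi\psi_\xi)_\xi$, which sends pairs of solutions (with the same $\sigma$) to solutions of the DP equation linearized about $u_0$ in the moving frame; separated solutions $e^{\lambda t}v(\xi)$ of the latter are exactly solutions $v$ of the third-order ODE in the claim. *)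

theory Defs
  imports "HOL-Analysis.Analysis"
begin

definition nderiv :: "nat \<Rightarrow> (real \<Rightarrow> 'a::real_normed_vector) \<Rightarrow> real \<Rightarrow> 'a" where
  "nderiv n f = ((\<lambda>g x. vector_derivative g (at x)) ^^ n) f"

definition times_differentiable :: "nat \<Rightarrow> (real \<Rightarrow> 'a::real_normed_vector) \<Rightarrow> bool" where
  "times_differentiable n f \<longleftrightarrow> (\<forall>i<n. \<forall>x. nderiv i f differentiable (at x))"

definition smooth :: "(real \<Rightarrow> 'a::real_normed_vector) \<Rightarrow> bool" where
  "smooth f \<longleftrightarrow> (\<forall>n. times_differentiable n f)"

text \<open>Functions of space and time take the space variable first.\<close>

definition dx :: "nat \<Rightarrow> (real \<Rightarrow> real \<Rightarrow> 'a::real_normed_vector) \<Rightarrow> real \<Rightarrow> real \<Rightarrow> 'a" where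
  "dx n f x t = nderiv n (\<lambda>y. f y t) x"

definition dt :: "(real \<Rightarrow> real \<Rightarrow> 'a::real_normed_vector) \<Rightarrow> real \<Rightarrow> real \<Rightarrow> 'a" where
  "dt f x t = nderiv 1 (f x) t"

definition dp_equation :: "(real \<Rightarrow> real \<Rightarrow> real) \<Rightarrow> bool" where
  "dp_equation u \<longleftrightarrow> (\<forall>x t.
     dt u x t - dx 2 (dt u) x t =
       3 * dx 1 u x t * dx 2 u x t - 4 * u x t * dx 1 u x t + u x t * dx 3 u x t)"

definition momentum :: "(real \<Rightarrow> real) \<Rightarrow> real \<Rightarrow> real" where
  "momentum u\<^sub>0 \<xi> = u\<^sub>0 \<xi> - nderiv 2 u\<^sub>0 \<xi>"

text \<open>
  The condition \<open>dp_equation\<close> is redundant: it follows by differentiating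
  \<open>(c - u\<^sub>0)^3 m = k (c - k)^3\<close> and dividing by \<open>(c - u\<^sub>0)^2\<close>.
\<close>

definition solitary_profile :: "real \<Rightarrow> real \<Rightarrow> (real \<Rightarrow> real) \<Rightarrow> bool" where
  "solitary_profile k c u\<^sub>0 \<longleftrightarrow>
     smooth u\<^sub>0 \<and>
     dp_equation (\<lambda>x t. u\<^sub>0 (x - c * t)) \<and>
     \<not> (\<exists>a. \<forall>\<xi>. u\<^sub>0 \<xi> = a) \<and>
     (\<forall>\<xi>. u\<^sub>0 (- \<xi>) = u\<^sub>0 \<xi>) \<and>
     (\<forall>\<xi>. (c - u\<^sub>0 \<xi>) ^ 3 * momentum u\<^sub>0 \<xi> = k * (c - k) ^ 3) \<and>
     nderiv 1 u\<^sub>0 0 = 0 \<and>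
     (u\<^sub>0 \<longlongrightarrow> k) at_infinity \<and>
     (\<forall>\<xi>. 0 < u\<^sub>0 \<xi> \<and> u\<^sub>0 \<xi> < c) \<and>
     (\<forall>\<xi>. momentum u\<^sub>0 \<xi> > 0)"

text \<open>
  Only separate differentiability is required below: the spatial equation is a linear
  ordinary differential equation in \<open>\<xi>\<close> with a three-dimensional solution space, so for
  smooth \<open>u\<^sub>0\<close> joint smoothness of a solution is automatic.
\<close>

definition lax_solution ::
  "real \<Rightarrow> (real \<Rightarrow> real) \<Rightarrow> complex \<Rightarrow> (real \<Rightarrow> real \<Rightarrow> complex) \<Rightarrow> bool" where
  "lax_solution c u\<^sub>0 \<sigma> \<phi> \<longleftrightarrow>
     (\<forall>t. times_differentiable 3 (\<lambda>\<xi>. \<phi> \<xi> t)) \<and>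
     (\<forall>\<xi>. times_differentiable 1 (\<phi> \<xi>)) \<and>
     (\<forall>\<xi> t.
        dx 3 \<phi> \<xi> t = dx 1 \<phi> \<xi> t + \<sigma> * of_real (momentum u\<^sub>0 \<xi>) * \<phi> \<xi> t \<and>
        dt \<phi> \<xi> t = 1 / \<sigma> * dx 2 \<phi> \<xi> t + of_real (c - u\<^sub>0 \<xi>) * dx 1 \<phi> \<xi> t
                   + of_real (nderiv 1 u\<^sub>0 \<xi>) * \<phi> \<xi> t)"

definition adjoint_lax_solution ::
  "real \<Rightarrow> (real \<Rightarrow> real) \<Rightarrow> complex \<Rightarrow> (real \<Rightarrow> real \<Rightarrow> complex) \<Rightarrow> bool" where
  "adjoint_lax_solution c u\<^sub>0 \<sigma> \<psi> \<longleftrightarrow>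
     (\<forall>t. times_differentiable 3 (\<lambda>\<xi>. \<psi> \<xi> t)) \<and>
     (\<forall>\<xi>. times_differentiable 1 (\<psi> \<xi>)) \<and>
     (\<forall>\<xi> t.
        dx 3 \<psi> \<xi> t = dx 1 \<psi> \<xi> t - \<sigma> * of_real (momentum u\<^sub>0 \<xi>) * \<psi> \<xi> t \<and>
        dt \<psi> \<xi> t = - (1 / \<sigma>) * dx 2 \<psi> \<xi> t + of_real (c - u\<^sub>0 \<xi>) * dx 1 \<psi> \<xi> t
                   + of_real (nderiv 1 u\<^sub>0 \<xi>) * \<psi> \<xi> t)"

definition squared_eigenfunction ::
  "(real \<Rightarrow> real \<Rightarrow> complex) \<Rightarrow> (real \<Rightarrow> real \<Rightarrow> complex) \<Rightarrow> real \<Rightarrow> real \<Rightarrow> complex" where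
  "squared_eigenfunction \<phi> \<psi> =
     dx 1 (\<lambda>\<xi> t. \<phi> \<xi> t * \<psi> \<xi> t - dx 1 \<phi> \<xi> t * dx 1 \<psi> \<xi> t)"

definition spectral_solution ::
  "real \<Rightarrow> (real \<Rightarrow> real) \<Rightarrow> complex \<Rightarrow> (real \<Rightarrow> complex) \<Rightarrow> bool" where
  "spectral_solution c u\<^sub>0 \<mu> v \<longleftrightarrow>
     times_differentiable 3 v \<and>
     (\<forall>\<xi>. \<mu> * (v \<xi> - nderiv 2 v \<xi>) =
        of_real c * nderiv 1 (\<lambda>y. v y - nderiv 2 v y) \<xi>
        + 3 * of_real (nderiv 1 u\<^sub>0 \<xi>) * nderiv 2 v \<xi>
        + 3 * of_real (nderiv 2 u\<^sub>0 \<xi>) * nderiv 1 v \<xi>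
        - 4 * of_real (u\<^sub>0 \<xi>) * nderiv 1 v \<xi>
        - 4 * of_real (nderiv 1 u\<^sub>0 \<xi>) * v \<xi>
        + of_real (u\<^sub>0 \<xi>) * nderiv 3 v \<xi>
        + of_real (nderiv 3 u\<^sub>0 \<xi>) * v \<xi>)"

definition lin_indep_family :: "nat set \<Rightarrow> (nat \<Rightarrow> real \<Rightarrow> complex) \<Rightarrow> bool" where
  "lin_indep_family J v \<longleftrightarrow>
     (\<forall>a :: nat \<Rightarrow> complex. (\<forall>\<xi>. (\<Sum>j\<in>J. a j * v j \<xi>) = 0) \<longrightarrow> (\<forall>j\<in>J. a j = 0))"

end

theory Submission
  imports Defs "HOL-Computational_Algebra.Fundamental_Theorem_Algebra"
begin

text \<open>
  The time flow acts on the three-dimensional solution space of the spatial Lax equation.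
  Eliminating \<open>\<phi>''\<close> from the equation of an eigenfunction with eigenvalue \<open>\<eta>\<close> and its derivative
  leaves \<open>D \<phi>' = N \<phi>\<close> with \<open>D = \<sigma> (c - u)\<^sup>2 + \<eta> - 1/\<sigma>\<close> and
  \<open>N = u + \<sigma> (c - u) (\<eta> - u')\<close>, so \<open>\<phi> = exp (\<integral> N/D)\<close> provided that \<open>D\<close> has no zeros. The profile
  satisfies \<open>(c - u)\<^sup>2 - 2 k (c - u) - k (c - k) \<ge> 0\<close> by its first integral; hence at a zero of \<open>D\<close>
  the exponent \<open>r\<close> of \<open>\<phi>\<close> at infinity would be real, which is incompatible with an imaginary
  difference of eigenvalues. The adjoint Lax pair is the Lax pair for \<open>-\<sigma>\<close>, so the adjoint
  eigenfunction is of the same form, with exponent \<open>-s\<close> at infinity. The squared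
  eigenfunctions behave like \<open>exp (z \<xi>)\<close> at \<open>+\<infinity>\<close>, where \<open>z = r - s\<close> runs through the roots of
  a cubic. These are non-real and simple, and a Vandermonde determinant gives linear independence.
\<close>

section \<open>Real roots of biquadratic equations, and elementary calculus\<close>

text \<open>The quadratic in \<open>r^2\<close> has nonnegative discriminant, so \<open>r^2\<close>
  is real. At a negative value of \<open>r^2\<close> every term would be nonnegative and the last
  one positive, so \<open>r^2\<close> is nonnegative and its square roots are real. This is the
  common source of contradiction for zeros of the denominator \<open>D\<close> and for multiple
  exponents.\<close>

lemma real_if_square_root_of_real_quadratic:
  fixes \<alpha> \<beta> \<gamma> :: real and r :: complex
  assumes "\<alpha> > 0" "\<beta> > 0" "\<gamma> > 0" and disc: "\<beta>^2 \<ge> 4 * \<alpha> * \<gamma>"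
    and root: "of_real \<alpha> * (r^2)^2 - of_real \<beta> * r^2 + of_real \<gamma> = 0"
  shows "r \<in> \<real>"
proof -
  have real: "y \<in> \<real>" if "y^2 = of_real d" "d \<ge> 0" for y :: complex and d :: real
  proof -
    have "y^2 = (of_real (sqrt d))^2"
      using that by (simp flip: of_real_power)
    then show ?thesis
      by (auto simp: power2_eq_iff)
  qed
  have "(2 * of_real \<alpha> * r^2 - of_real \<beta>)^2
      = 4 * of_real \<alpha> * (of_real \<alpha> * (r^2)^2 - of_real \<beta> * r^2 + of_real \<gamma>)
        + of_real (\<beta>^2 - 4 * \<alpha> * \<gamma>)"
    by (simp add: algebra_simps power2_eq_square)
  then have "(2 * of_real \<alpha> * r^2 - of_real \<beta>)^2 = of_real (\<beta>^2 - 4 * \<alpha> * \<gamma>)"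
    using root by simp
  then have "2 * of_real \<alpha> * r^2 - of_real \<beta> \<in> \<real>"
    using disc by (intro real[of _ "\<beta>^2 - 4 * \<alpha> * \<gamma>"]) auto
  then obtain e where e: "2 * of_real \<alpha> * r^2 - of_real \<beta> = complex_of_real e"
    by (auto elim: Reals_cases)
  define R where "R = (e + \<beta>) / (2 * \<alpha>)"
  have R: "r^2 = of_real R"
    using e \<open>\<alpha> > 0\<close> by (simp add: R_def field_simps)
  have "complex_of_real (\<alpha> * R^2 - \<beta> * R + \<gamma>) = 0"
    using root by (simp add: R)
  then have eq: "\<alpha> * R^2 - \<beta> * R + \<gamma> = 0"
    by (simp only: of_real_eq_0_iff)
  have "R \<ge> 0"
  proof (rule ccontr)
    assume "\<not> R \<ge> 0"
    then have "\<beta> * R < 0" using \<open>\<beta> > 0\<close> by (simp add: mult_pos_neg)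
    moreover have "\<alpha> * R^2 \<ge> 0" using \<open>\<alpha> > 0\<close> by simp
    ultimately show False using eq \<open>\<gamma> > 0\<close> by linarith
  qed
  then show ?thesis using R by (intro real)
qed

lemma exists_antiderivative:
  fixes f :: "real \<Rightarrow> 'a :: euclidean_space"
  assumes "continuous_on UNIV f"
  obtains F where "\<And>x. (F has_vector_derivative f x) (at x)"
proof -
  have "\<exists>F. \<forall>x. - \<infinity> < ereal x \<longrightarrow> ereal x < \<infinity> \<longrightarrow> (F has_vector_derivative f x) (at x)"
    using assms
    by (intro einterval_antiderivative) (auto simp: continuous_on_eq_continuous_at)
  then show ?thesis using that by auto
qed

lemma has_vector_derivative_exp:
  fixes f :: "real \<Rightarrow> complex"
  assumes "(f has_vector_derivative f') (at x)"
  shows "((\<lambda>x. exp (f x)) has_vector_derivative f' * exp (f x)) (at x)"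
  using field_vector_diff_chain_at[OF assms DERIV_exp] by (simp add: o_def)

lemma has_vector_derivative_quotient:
  fixes f g :: "real \<Rightarrow> complex"
  assumes f: "(f has_vector_derivative f') (at x)" and g: "(g has_vector_derivative g') (at x)"
    and "g x \<noteq> 0"
  shows "((\<lambda>x. f x / g x) has_vector_derivative (f' * g x - f x * g') / (g x)^2) (at x)"
proof -
  have "((\<lambda>x. inverse (g x)) has_vector_derivative g' * - (inverse (g x) ^ Suc (Suc 0))) (at x)"
    using field_vector_diff_chain_at[OF g DERIV_inverse] \<open>g x \<noteq> 0\<close> by (simp add: o_def)
  from has_vector_derivative_mult[OF f this] show ?thesis
    using \<open>g x \<noteq> 0\<close> by (simp add: field_simps power2_eq_square)
qed

section \<open>Iterated derivatives and limits of derivatives\<close>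

lemma nderiv_0 [simp]: "nderiv 0 f = f"
  by (simp add: nderiv_def)

lemma nderiv_Suc: "nderiv (Suc n) f = (\<lambda>x. vector_derivative (nderiv n f) (at x))"
  by (simp add: nderiv_def)

lemma nderiv_1_eqI:
  assumes "\<And>x. (f has_vector_derivative f1 x) (at x)"
  shows "nderiv (Suc 0) f = f1"
  using assms by (auto simp: nderiv_Suc vector_derivative_at)

lemma nderiv_2_eqI:
  assumes "\<And>x. (f has_vector_derivative f1 x) (at x)"
    and "\<And>x. (f1 has_vector_derivative f2 x) (at x)"
  shows "nderiv 2 f = f2"
  using assms(2) by (auto simp: numeral_2_eq_2 nderiv_Suc[of "Suc 0"] nderiv_1_eqI[OF assms(1)]
      vector_derivative_at)

lemma nderiv_3_eqI:
  assumes "\<And>x. (f has_vector_derivative f1 x) (at x)"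
    and "\<And>x. (f1 has_vector_derivative f2 x) (at x)"
    and "\<And>x. (f2 has_vector_derivative f3 x) (at x)"
  shows "nderiv 3 f = f3"
proof -
  have "nderiv 3 f = (\<lambda>x. vector_derivative (nderiv 2 f) (at x))"
    using nderiv_Suc[of 2 f] by simp
  then show ?thesis
    by (simp add: nderiv_2_eqI[OF assms(1,2)] vector_derivative_at[OF assms(3)])
qed

lemma times_differentiable_1I:
  assumes "\<And>x. (f has_vector_derivative f1 x) (at x)"
  shows "times_differentiable 1 f"
  using assms by (auto simp: times_differentiable_def intro: differentiableI_vector)

lemma times_differentiable_3I:
  assumes "\<And>x. (f has_vector_derivative f1 x) (at x)"
    and "\<And>x. (f1 has_vector_derivative f2 x) (at x)"
    and "\<And>x. (f2 has_vector_derivative f3 x) (at x)"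
  shows "times_differentiable 3 f"
proof -
  have "nderiv i f differentiable (at x)" if "i < 3" for i x
  proof -
    have "i = 0 \<or> i = Suc 0 \<or> i = 2" using that by linarith
    then show ?thesis
      by (elim disjE) (simp_all add: nderiv_1_eqI[OF assms(1)] nderiv_2_eqI[OF assms(1,2)]
          differentiableI_vector[OF assms(1)] differentiableI_vector[OF assms(2)]
          differentiableI_vector[OF assms(3)])
  qed
  then show ?thesis by (simp add: times_differentiable_def)
qed

lemma smooth_has_vector_derivative:
  assumes "smooth f"
  shows "(nderiv n f has_vector_derivative nderiv (Suc n) f x) (at x)"
  using assms unfolding smooth_def times_differentiable_def nderiv_Suc
  by (metis lessI vector_derivative_works)

lemma adjoint_lax_solution_iff:
  "adjoint_lax_solution c u \<sigma> \<psi> \<longleftrightarrow> lax_solution c u (- \<sigma>) \<psi>"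
  by (simp add: adjoint_lax_solution_def lax_solution_def)

text \<open>By the mean value theorem \<open>f (x + 1) - f x\<close> is a value of \<open>f1\<close>
  on the unit interval after \<open>x\<close>, hence small; on that interval \<open>f1\<close>
  varies by no more than the size of \<open>f2\<close>.\<close>

lemma tendsto_derivative_zero:
  fixes f f1 f2 :: "real \<Rightarrow> real"
  assumes f: "\<And>x. (f has_real_derivative f1 x) (at x)"
    and f1: "\<And>x. (f1 has_real_derivative f2 x) (at x)"
    and lim: "(f \<longlongrightarrow> l) at_top" and lim2: "(f2 \<longlongrightarrow> 0) at_top"
  shows "(f1 \<longlongrightarrow> 0) at_top"
proof (rule tendstoI)
  fix e :: real assume "e > 0"
  have "\<forall>\<^sub>F x in at_top. dist (f x) l < e / 4"
    using tendstoD[OF lim, of "e / 4"] \<open>e > 0\<close> by simp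
  moreover have "\<forall>\<^sub>F x in at_top. dist (f2 x) 0 < e / 2"
    using tendstoD[OF lim2, of "e / 2"] \<open>e > 0\<close> by simp
  ultimately have "\<forall>\<^sub>F x in at_top. dist (f x) l < e / 4 \<and> dist (f2 x) 0 < e / 2"
    by (rule eventually_conj)
  then obtain B where B: "\<And>x. x \<ge> B \<Longrightarrow> \<bar>f x - l\<bar> < e / 4 \<and> \<bar>f2 x\<bar> < e / 2"
    by (auto simp: eventually_at_top_linorder dist_real_def)
  have "\<bar>f1 x\<bar> < e" if x: "x \<ge> B" for x
  proof -
    obtain y where y: "x < y" "y < x + 1" "f (x + 1) - f x = (x + 1 - x) * f1 y"
      using MVT2[of x "x + 1" f f1] f by auto
    obtain z where z: "x < z" "z < y" "f1 y - f1 x = (y - x) * f2 z"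
      using MVT2[of x y f1 f2] f1 y by auto
    have "\<bar>f1 y\<bar> < e / 2"
      using y(3) B[of x] B[of "x + 1"] x by (simp add: abs_if split: if_splits)
    moreover have "\<bar>(y - x) * f2 z\<bar> \<le> 1 * \<bar>f2 z\<bar>"
      unfolding abs_mult using y by (intro mult_right_mono) auto
    moreover have "\<bar>f2 z\<bar> < e / 2" using B[of z] z x by simp
    ultimately show ?thesis using z(3) by linarith
  qed
  then show "\<forall>\<^sub>F x in at_top. dist (f1 x) 0 < e"
    by (auto simp: eventually_at_top_linorder)
qed

section \<open>The solitary wave profile: limits and first integral\<close>

text \<open>Here \<open>u1\<close> is the derivative of the profile and \<open>m\<close> its
  momentum, so that \<open>u - m\<close> is the second derivative. All asymptotics are taken at
  +\<infinity>.\<close>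

locale dp_profile =
  fixes c k :: real and u u1 m :: "real \<Rightarrow> real"
  assumes k_pos: "0 < k" and k_less: "4 * k < c"
    and u_less: "\<And>x. u x < c"
    and deriv_u: "\<And>x. (u has_real_derivative u1 x) (at x)"
    and deriv_u1: "\<And>x. (u1 has_real_derivative u x - m x) (at x)"
    and m_eq: "\<And>x. (c - u x) ^ 3 * m x = k * (c - k) ^ 3"
    and lim_u: "(u \<longlongrightarrow> k) at_top"
begin

text \<open>The derivative of \<open>m\<close>, by logarithmic differentiation of
  \<open>m_eq\<close>.\<close>

definition m1 :: "real \<Rightarrow> real" where
  "m1 x = 3 * u1 x * m x / (c - u x)"

lemma w_nonzero [simp]: "c - u x \<noteq> 0" "c \<noteq> u x"
  using u_less[of x] by auto

lemma m_eq_divide: "m x = k * (c - k) ^ 3 / (c - u x) ^ 3"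
  using m_eq[of x] by (simp add: field_simps)

lemma deriv_m: "(m has_real_derivative m1 x) (at x)"
proof -
  have "((\<lambda>x. k * (c - k) ^ 3 / (c - u x) ^ 3) has_real_derivative
      k * (c - k) ^ 3 * (3 * (c - u x)^2 * u1 x) / ((c - u x) ^ 3)^2) (at x)"
    by (auto intro!: derivative_eq_intros deriv_u simp: power2_eq_square)
  also have "k * (c - k) ^ 3 * (3 * (c - u x)^2 * u1 x) / ((c - u x) ^ 3)^2 = m1 x"
    unfolding m1_def m_eq_divide by (simp add: divide_simps) (simp add: eval_nat_numeral)
  also have "(\<lambda>x. k * (c - k) ^ 3 / (c - u x) ^ 3) = m"
    by (simp add: m_eq_divide fun_eq_iff)
  finally show ?thesis .
qed

text \<open>The second derivative of \<open>m\<close>, from differentiating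
  \<open>(c - u) * m1 = 3 * u1 * m\<close>.\<close>

definition m2 :: "real \<Rightarrow> real" where
  "m2 x = (3 * (u x - m x) * m x + 4 * u1 x * m1 x) / (c - u x)"

lemma deriv_m1: "(m1 has_real_derivative m2 x) (at x)"
proof -
  have "((\<lambda>x. 3 * u1 x * m x / (c - u x)) has_real_derivative
      ((3 * (u x - m x) * m x + 3 * u1 x * m1 x) * (c - u x) + 3 * u1 x * m x * u1 x)
        / (c - u x)^2) (at x)"
    by (auto intro!: derivative_eq_intros deriv_u deriv_u1 deriv_m simp: power2_eq_square)
  also have "((3 * (u x - m x) * m x + 3 * u1 x * m1 x) * (c - u x) + 3 * u1 x * m x * u1 x)
        / (c - u x)^2 = m2 x"
    unfolding m1_def m2_def by (simp add: divide_simps) (simp add: algebra_simps power2_eq_square)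
  finally show ?thesis
    by (simp add: m1_def[abs_def])
qed

lemma k_less_c: "k < c"
  using k_pos k_less by linarith

lemma lim_m: "(m \<longlongrightarrow> k) at_top"
proof -
  have "((\<lambda>x. k * (c - k) ^ 3 / (c - u x) ^ 3) \<longlongrightarrow> k * (c - k) ^ 3 / (c - k) ^ 3) at_top"
    using k_less_c by (intro tendsto_intros lim_u) auto
  then show ?thesis
    using k_less_c by (simp add: m_eq_divide[abs_def])
qed

lemma lim_u1: "(u1 \<longlongrightarrow> 0) at_top"
proof (rule tendsto_derivative_zero[OF deriv_u deriv_u1 lim_u])
  show "((\<lambda>x. u x - m x) \<longlongrightarrow> 0) at_top"
    using tendsto_diff[OF lim_u lim_m] by simp
qed

lemma lim_m1: "(m1 \<longlongrightarrow> 0) at_top"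
proof -
  have "((\<lambda>x. 3 * u1 x * m x / (c - u x)) \<longlongrightarrow> 3 * 0 * k / (c - k)) at_top"
    using k_less_c by (intro tendsto_intros lim_u lim_m lim_u1) auto
  then show ?thesis
    by (simp add: m1_def[abs_def])
qed

text \<open>Multiplying u'' = u - m by 2u' gives an exact equation, because (m (c - u))' = 2mu' by
  the formula for \<open>m1\<close>. The constant of integration is read off at
  +\<infinity>.\<close>

lemma first_integral: "u1 x ^ 2 = u x ^ 2 - m x * (c - u x) + k * (c - k) - k ^ 2"
proof -
  define F where "F x = u1 x ^ 2 - u x ^ 2 + m x * (c - u x)" for x
  have "(F has_real_derivative
      2 * u1 x * (u x - m x) - 2 * u x * u1 x + (m1 x * (c - u x) - m x * u1 x)) (at x)" for x
    unfolding F_def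
    by (auto intro!: derivative_eq_intros deriv_u deriv_u1 deriv_m)
  moreover have "2 * u1 x * (u x - m x) - 2 * u x * u1 x + (m1 x * (c - u x) - m x * u1 x) = 0"
    for x
    by (simp add: m1_def) (simp add: algebra_simps)
  ultimately have const: "F y = F x" for y
    using DERIV_isconst_all[of F] by metis
  have "(F \<longlongrightarrow> 0 ^ 2 - k ^ 2 + k * (c - k)) at_top"
    unfolding F_def by (intro tendsto_intros lim_u lim_u1 lim_m)
  moreover have "(F \<longlongrightarrow> F x) at_top"
    using const by (intro tendsto_eventually always_eventually) blast
  ultimately have "F x = 0 ^ 2 - k ^ 2 + k * (c - k)"
    using tendsto_unique[OF trivial_limit_at_top_linorder] by blast
  then show ?thesis
    by (simp add: F_def)
qed

lemma nderiv_u: "nderiv (Suc 0) u = u1" "nderiv 2 u = (\<lambda>x. u x - m x)"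
  "nderiv 3 u = (\<lambda>x. u1 x - m1 x)"
proof -
  note d = deriv_u[unfolded has_real_derivative_iff_has_vector_derivative]
    deriv_u1[unfolded has_real_derivative_iff_has_vector_derivative]
    DERIV_diff[OF deriv_u deriv_m, unfolded has_real_derivative_iff_has_vector_derivative]
  show "nderiv (Suc 0) u = u1" by (rule nderiv_1_eqI[OF d(1)])
  show "nderiv 2 u = (\<lambda>x. u x - m x)" by (rule nderiv_2_eqI[OF d(1,2)])
  show "nderiv 3 u = (\<lambda>x. u1 x - m1 x)" by (rule nderiv_3_eqI[OF d])
qed

lemma momentum_u: "momentum u = m"
  by (simp add: momentum_def fun_eq_iff nderiv_u)

section \<open>The time flow on solutions of the spatial equation, and the amplitude bound\<close>

text \<open>The hypothesis \<open>T\<close> makes \<open>p\<close> an eigenfunction of the time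
  operator with eigenvalue \<eta>, so its time evolution is multiplication by an
  exponential.\<close>

lemma separated_lax_solution:
  fixes p p1 p2 :: "real \<Rightarrow> complex"
  assumes p: "\<And>x. (p has_vector_derivative p1 x) (at x)"
    and p1: "\<And>x. (p1 has_vector_derivative p2 x) (at x)"
    and p2: "\<And>x. (p2 has_vector_derivative p1 x + \<sigma> * of_real (m x) * p x) (at x)"
    and T: "\<And>x. \<eta> * p x = p2 x / \<sigma> + of_real (c - u x) * p1 x + of_real (u1 x) * p x"
  shows "lax_solution c u \<sigma> (\<lambda>\<xi> t. exp (\<eta> * of_real t) * p \<xi>)"
proof -
  define E where "E t = exp (\<eta> * of_real t)" for t :: real
  have time: "((\<lambda>t. E t * p x) has_vector_derivative \<eta> * E t * p x) (at t)" for x t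
  proof -
    have "((\<lambda>t. \<eta> * complex_of_real t) has_vector_derivative \<eta> * of_real 1) (at t)"
      by (intro has_vector_derivative_mult_right has_vector_derivative_of_real) simp
    from has_vector_derivative_mult_left[OF has_vector_derivative_exp[OF this]]
    show ?thesis by (simp add: E_def)
  qed
  note Ep = has_vector_derivative_mult_right[OF p] has_vector_derivative_mult_right[OF p1]
    has_vector_derivative_mult_right[OF p2]
  have "E t * (\<eta> * p x) = E t * (1 / \<sigma> * p2 x + of_real (c - u x) * p1 x + of_real (u1 x) * p x)"
    for x t
    by (simp add: T)
  then have "\<eta> * E t * p x = 1 / \<sigma> * (E t * p2 x) + of_real (c - u x) * (E t * p1 x)
      + of_real (u1 x) * (E t * p x)" for x t
    by (simp add: algebra_simps)
  then have "lax_solution c u \<sigma> (\<lambda>\<xi> t. E t * p \<xi>)"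
    unfolding lax_solution_def dx_def dt_def
    by (simp add: times_differentiable_3I[OF Ep] times_differentiable_1I[OF time, unfolded One_nat_def]
        nderiv_1_eqI[OF time] nderiv_1_eqI[OF Ep(1)] nderiv_2_eqI[OF Ep(1,2)] nderiv_3_eqI[OF Ep]
        momentum_u nderiv_u) (simp add: algebra_simps)
  then show ?thesis by (simp add: E_def)
qed

text \<open>The eigenvalue equation and its first two space derivatives, with third derivatives
  removed by the spatial equation. Together they say that \<open>(p, p1, p2)\<close> is an
  eigenvector of a 3 by 3 matrix whose entries depend on \<open>x\<close>.\<close>

lemma time_flow_matrix:
  fixes p p1 p2 :: "real \<Rightarrow> complex"
  assumes "\<sigma> \<noteq> 0"
    and p: "\<And>x. (p has_vector_derivative p1 x) (at x)"
    and p1: "\<And>x. (p1 has_vector_derivative p2 x) (at x)"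
    and p2: "\<And>x. (p2 has_vector_derivative p1 x + \<sigma> * of_real (m x) * p x) (at x)"
    and T: "\<And>x. \<eta> * p x = p2 x / \<sigma> + of_real (c - u x) * p1 x + of_real (u1 x) * p x"
  shows "\<sigma> * \<eta> * p x = p2 x + \<sigma> * (of_real (c - u x) * p1 x + of_real (u1 x) * p x)"
    and "\<sigma> * \<eta> * p1 x = p1 x + \<sigma> * (of_real (c - u x) * p2 x + of_real (u x) * p x)"
    and "\<sigma> * \<eta> * p2 x = p2 x + \<sigma> * (- of_real (u1 x) * p2 x + of_real c * p1 x
      + (\<sigma> * of_real (c - u x) * of_real (m x) + of_real (u1 x)) * p x)"
proof -
  have w: "((\<lambda>x. complex_of_real (c - u x)) has_vector_derivative of_real (- u1 x)) (at x)" for x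
    by (intro has_vector_derivative_of_real) (auto intro!: derivative_eq_intros deriv_u)
  note du = has_vector_derivative_of_real[OF deriv_u, where 'a = complex]
  note du1 = has_vector_derivative_of_real[OF deriv_u1, where 'a = complex]
  have T0: "\<sigma> * \<eta> * p x = p2 x + \<sigma> * (of_real (c - u x) * p1 x + of_real (u1 x) * p x)" for x
  proof -
    have "\<sigma> * (\<eta> * p x) = p2 x + \<sigma> * (of_real (c - u x) * p1 x + of_real (u1 x) * p x)"
      unfolding T using \<open>\<sigma> \<noteq> 0\<close> by (simp add: algebra_simps)
    then show ?thesis by (simp add: mult.assoc)
  qed
  then show "\<sigma> * \<eta> * p x = p2 x + \<sigma> * (of_real (c - u x) * p1 x + of_real (u1 x) * p x)" .
  have T1: "\<sigma> * \<eta> * p1 x = p1 x + \<sigma> * (of_real (c - u x) * p2 x + of_real (u x) * p x)" for x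
  proof (rule trans, rule vector_derivative_unique_at)
    show "((\<lambda>x. \<sigma> * \<eta> * p x) has_vector_derivative \<sigma> * \<eta> * p1 x) (at x)"
      by (rule has_vector_derivative_mult_right[OF p])
    show "((\<lambda>x. \<sigma> * \<eta> * p x) has_vector_derivative
        p1 x + \<sigma> * of_real (m x) * p x +
        \<sigma> * ((of_real (c - u x) * p2 x + of_real (- u1 x) * p1 x) +
             (of_real (u1 x) * p1 x + of_real (u x - m x) * p x))) (at x)"
      unfolding T0
      by (rule has_vector_derivative_add has_vector_derivative_mult_right
          has_vector_derivative_mult p p1 p2 w du1)+
  qed (simp add: algebra_simps)
  then show "\<sigma> * \<eta> * p1 x = p1 x + \<sigma> * (of_real (c - u x) * p2 x + of_real (u x) * p x)" .
  show "\<sigma> * \<eta> * p2 x = p2 x + \<sigma> * (- of_real (u1 x) * p2 x + of_real c * p1 x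
      + (\<sigma> * of_real (c - u x) * of_real (m x) + of_real (u1 x)) * p x)"
  proof (rule trans, rule vector_derivative_unique_at)
    show "((\<lambda>x. \<sigma> * \<eta> * p1 x) has_vector_derivative \<sigma> * \<eta> * p2 x) (at x)"
      by (rule has_vector_derivative_mult_right[OF p1])
    show "((\<lambda>x. \<sigma> * \<eta> * p1 x) has_vector_derivative
        p2 x + \<sigma> * ((of_real (c - u x) * (p1 x + \<sigma> * of_real (m x) * p x)
               + of_real (- u1 x) * p2 x) +
             (of_real (u x) * p1 x + of_real (u1 x) * p x))) (at x)"
      unfolding T1
      by (rule has_vector_derivative_add has_vector_derivative_mult_right
          has_vector_derivative_mult p p1 p2 w du)+
  qed (simp add: algebra_simps)
qed

text \<open>The first integral, multiplied by \<open>(c - u x)^2\<close>, factors as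
  \<open>(u1 x * (c - u x))^2 = (u x - k)^2\<close> times the left-hand side. Where
  \<open>u x = k\<close> this gives nothing, and \<open>4 * k < c\<close> is used directly.\<close>

lemma amplitude_bound: "(c - u x)^2 - 2 * k * (c - u x) - k * (c - k) \<ge> 0"
proof (cases "u x = k")
  case True
  have "(c - k)^2 - 2 * k * (c - k) - k * (c - k) = (c - k) * (c - 4 * k)"
    by (simp add: algebra_simps power2_eq_square)
  then show ?thesis
    using True k_less_c k_less by simp
next
  case False
  have mw: "m x * (c - u x) * (c - u x)^2 = k * (c - k)^3"
    using m_eq[of x] by (simp add: power2_eq_square power3_eq_cube algebra_simps)
  have "(u1 x * (c - u x))^2
      = (u x ^ 2 + k * (c - k) - k ^ 2) * (c - u x)^2 - m x * (c - u x) * (c - u x)^2"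
    unfolding power_mult_distrib first_integral by (simp add: algebra_simps)
  also have "\<dots> = (u x - k)^2 * ((c - u x)^2 - 2 * k * (c - u x) - k * (c - k))"
    unfolding mw by (simp add: power2_eq_square power3_eq_cube algebra_simps)
  finally have "(u x - k)^2 * ((c - u x)^2 - 2 * k * (c - u x) - k * (c - k)) \<ge> 0"
    by (metis zero_le_power2)
  then show ?thesis
    using False by (simp add: zero_le_mult_iff)
qed

end

section \<open>Eigenfunctions of the Lax pair by a Riccati equation\<close>

text \<open>\<open>r\<close> and \<open>s\<close> are two roots of x^3 - x = k\<sigma>: the
  condition \<open>r_s\<close> is the divided difference of x^3 - x equated to zero. They are the
  exponents at infinity of \<phi> and of 1/\<psi>, and \<mu> is the difference of the corresponding
  time eigenvalues.\<close>

locale dp_eigenfunction = dp_profile +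
  fixes \<sigma> r s \<mu> :: complex
  assumes \<sigma>_nonzero: "\<sigma> \<noteq> 0"
    and r_root: "of_real k * \<sigma> = r ^ 3 - r"
    and r_s: "r^2 + r * s + s^2 = 1"
    and \<mu>_eq: "\<mu> = (r^2 - s^2) / \<sigma> + of_real (c - k) * (r - s)"
    and Re_\<mu>: "Re \<mu> = 0" and \<mu>_nonzero: "\<mu> \<noteq> 0"
begin

text \<open>The eigenvalue of the time operator on exp (r\<xi>) at the constant state u = k.\<close>

definition \<eta> :: complex where
  "\<eta> = r^2 / \<sigma> + of_real (c - k) * r"

lemma r_square_nonzero: "r^2 - 1 \<noteq> 0"
proof
  assume "r^2 - 1 = 0"
  then have "r^3 - r = 0" by (simp add: power2_eq_square power3_eq_cube)
  then show False using r_root \<sigma>_nonzero k_pos by auto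
qed

text \<open>If \<open>r\<close> were real, so would be \<sigma>. A real \<open>s\<close> would make
  \<mu> real, hence zero. A non-real \<open>s\<close> has real part \<open>- r / 2\<close> by the
  imaginary part of \<open>r_s\<close>; then the vanishing of \<open>Re \<mu>\<close>, multiplied by
  \<open>S^2 * \<rho>\<close>, equates a sum of two positive terms to zero.\<close>

lemma r_not_real: "r \<notin> \<real>"
proof
  assume "r \<in> \<real>"
  then obtain \<rho> where \<rho>: "r = of_real \<rho>" by (auto elim: Reals_cases)
  define S where "S = (\<rho>^3 - \<rho>) / k"
  have S: "\<sigma> = of_real S"
    using r_root k_pos unfolding \<rho> S_def by (simp add: field_simps)
  obtain x y where s: "s = Complex x y" by (cases s)
  have imag: "\<rho> * y + 2 * x * y = 0" and re: "\<rho>^2 + \<rho> * x + x^2 - y^2 = 1"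
    using r_s by (auto simp: \<rho> s complex_eq_iff power2_eq_square)
  have \<mu>: "\<mu> = (of_real (\<rho>^2) - s^2) / of_real S + of_real (c - k) * (of_real \<rho> - s)"
    using \<mu>_eq by (simp add: \<rho> S)
  have "y \<noteq> 0"
  proof
    assume "y = 0"
    then have "s = of_real x" by (simp add: s complex_eq_iff)
    then have "\<mu> = of_real ((\<rho>^2 - x^2) / S + (c - k) * (\<rho> - x))"
      unfolding \<mu> by simp
    then show False using Re_\<mu> \<mu>_nonzero by (metis Re_complex_of_real of_real_0)
  qed
  moreover have "y * (\<rho> + 2 * x) = 0"
    using imag by (simp add: algebra_simps)
  ultimately have x: "x = - \<rho> / 2"
    by simp
  have y: "y^2 = 3 / 4 * \<rho>^2 - 1"
    using re unfolding x by (simp add: power2_eq_square field_simps)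
  then have \<rho>_large: "\<rho>^2 > 4 / 3"
    using \<open>y \<noteq> 0\<close> zero_less_power2[of y] by linarith
  have "Re (s^2) = x^2 - y^2" by (simp add: s power2_eq_square)
  then have "(\<rho>^2 - (x^2 - y^2)) / S + (c - k) * (\<rho> - x) = 0"
    using Re_\<mu> unfolding \<mu> by (simp add: s Re_divide_of_real)
  moreover have "\<rho>^2 - (x^2 - y^2) = 3 / 2 * \<rho>^2 - 1" and "\<rho> - x = 3 / 2 * \<rho>"
    unfolding y unfolding x by (simp_all add: power2_eq_square)
  ultimately have eq: "(3 / 2 * \<rho>^2 - 1) / S + 3 / 2 * (c - k) * \<rho> = 0"
    by (simp add: mult_ac)
  have "S * \<rho> = \<rho>^2 * (\<rho>^2 - 1) / k"
    by (simp add: S_def field_simps eval_nat_numeral)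
  also have "\<dots> > 0"
    using \<rho>_large k_pos by (intro divide_pos_pos mult_pos_pos) linarith+
  finally have "S * \<rho> > 0" .
  then have "S \<noteq> 0" by auto
  have "0 < (3 / 2 * \<rho>^2 - 1) * (S * \<rho>) + 3 / 2 * (c - k) * (S * \<rho>)^2"
    using \<rho>_large \<open>S * \<rho> > 0\<close> k_less_c
    by (intro add_pos_pos mult_pos_pos[of _ "S * \<rho>"] mult_pos_pos[of _ "(S * \<rho>)^2"]) auto
  also have "\<dots> = ((3 / 2 * \<rho>^2 - 1) / S + 3 / 2 * (c - k) * \<rho>) * (S^2 * \<rho>)"
    using \<open>S \<noteq> 0\<close> by (simp add: field_simps power2_eq_square)
  finally show False by (simp only: eq)
qed

text \<open>Multiplied by \<open>k^2 * \<sigma>\<close> and rewritten by \<open>r_root\<close>, the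
  expression is \<open>r^2 - 1\<close> times a real quadratic in \<open>r^2\<close>. The assumption
  on \<open>w\<close> says that the middle coefficient is at least \<open>2 * k * w\<close>, which
  makes the discriminant nonnegative, so a zero would force \<open>r\<close> to be real.\<close>

lemma denominator_nonzero:
  fixes w :: real
  assumes "w > 0" and w: "w^2 - 2 * k * w - k * (c - k) \<ge> 0"
  shows "\<sigma> * of_real w ^ 2 + \<eta> - 1 / \<sigma> \<noteq> 0"
proof
  assume "\<sigma> * of_real w ^ 2 + \<eta> - 1 / \<sigma> = 0"
  then have "0 = of_real k ^ 2 * \<sigma> * (\<sigma> * of_real w ^ 2 + \<eta> - 1 / \<sigma>)"
    by simp
  also have "\<dots> = (of_real k * \<sigma>)^2 * of_real w ^ 2 + of_real k ^ 2 * (r^2 - 1)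
      + of_real k * of_real (c - k) * r * (of_real k * \<sigma>)"
    using \<sigma>_nonzero by (simp add: \<eta>_def field_simps power2_eq_square)
  also have "\<dots> = (r^2 - 1) * (of_real (w^2) * (r^2)^2 - of_real (w^2 - k * (c - k)) * r^2
      + of_real (k^2))"
    unfolding r_root by (simp add: algebra_simps eval_nat_numeral)
  finally have root: "of_real (w^2) * (r^2)^2 - of_real (w^2 - k * (c - k)) * r^2
      + of_real (k^2) = 0"
    using r_square_nonzero by simp
  have ge: "w^2 - k * (c - k) \<ge> 2 * k * w" using w by simp
  have "(w^2 - k * (c - k))^2 \<ge> (2 * k * w)^2"
    using ge k_pos \<open>w > 0\<close> by (intro power_mono) auto
  then have "r \<in> \<real>"
    using root order.strict_trans2[OF _ ge, of 0] k_pos \<open>w > 0\<close>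
    by (intro real_if_square_root_of_real_quadratic[of "w^2" "w^2 - k * (c - k)" "k^2"])
      (auto simp: power_mult_distrib mult_ac simp del: of_real_diff of_real_power)
  then show False using r_not_real by simp
qed

definition N :: "real \<Rightarrow> complex" where
  "N x = of_real (u x) + \<sigma> * of_real (c - u x) * (\<eta> - of_real (u1 x))"

definition D :: "real \<Rightarrow> complex" where
  "D x = \<sigma> * of_real (c - u x) ^ 2 + \<eta> - 1 / \<sigma>"

text \<open>The logarithmic derivative of the eigenfunction to be constructed.\<close>

definition g :: "real \<Rightarrow> complex" where
  "g x = N x / D x"

lemma D_nonzero: "D x \<noteq> 0"
  unfolding D_def using u_less[of x] amplitude_bound by (intro denominator_nonzero) auto

lemma D_limit_nonzero: "\<sigma> * of_real (c - k) ^ 2 + \<eta> - 1 / \<sigma> \<noteq> 0"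
proof (rule denominator_nonzero)
  have "(c - k)^2 - 2 * k * (c - k) - k * (c - k) = (c - k) * (c - 4 * k)"
    by (simp add: algebra_simps power2_eq_square)
  then show "(c - k)^2 - 2 * k * (c - k) - k * (c - k) \<ge> 0"
    using k_less_c k_less by simp
qed (use k_less_c in auto)

lemma lim_g: "(g \<longlongrightarrow> r) at_top"
proof -
  have "(g \<longlongrightarrow> (of_real k + \<sigma> * of_real (c - k) * (\<eta> - of_real 0))
      / (\<sigma> * of_real (c - k) ^ 2 + \<eta> - 1 / \<sigma>)) at_top"
    unfolding g_def N_def D_def
    by (intro tendsto_intros lim_u lim_u1 D_limit_nonzero)
  \<comment> \<open>At the constant state exp (r\<xi>) is itself an eigenfunction, so there the
    numerator is \<open>r\<close> times the denominator.\<close>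
  also have "of_real k + \<sigma> * of_real (c - k) * (\<eta> - of_real 0)
      = r * (\<sigma> * of_real (c - k) ^ 2 + \<eta> - 1 / \<sigma>)"
  proof -
    have "r * (\<sigma> * of_real (c - k) ^ 2 + \<eta> - 1 / \<sigma>) - \<sigma> * of_real (c - k) * \<eta>
        = (r ^ 3 - r) / \<sigma>"
      using \<sigma>_nonzero by (simp add: \<eta>_def field_simps eval_nat_numeral)
    also have "\<dots> = of_real k" using \<sigma>_nonzero by (simp flip: r_root)
    finally show ?thesis by (simp add: algebra_simps)
  qed
  finally show ?thesis using D_limit_nonzero by simp
qed

text \<open>
  This is the characteristic equation of the time flow on the solutions of the spatial equation.
\<close>

lemma characteristic_equation:
  "\<sigma> * \<eta> * of_real c ^ 2 + (\<sigma> * \<eta> - 1) * of_real (k * (c - k) - k^2)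
    + \<sigma>^2 * of_real (k * (c - k) ^ 3) = \<eta> / \<sigma> * (1 - \<sigma> * \<eta>)^2"
proof -
  \<comment> \<open>After multiplication by \<open>\<sigma>^2\<close>, both sides are polynomials in
    \<open>r\<close> and \<open>t\<close> alone, because \<open>k * \<sigma> = r ^ 3 - r\<close> and
    \<open>c * \<sigma> = t + b\<close>.\<close>
  define t where "t = of_real (c - k) * \<sigma>"
  define b where "b = of_real k * \<sigma>"
  have b: "b = r ^ 3 - r" by (simp add: b_def r_root)
  have \<sigma>\<eta>: "\<sigma> * \<eta> = r^2 + r * t"
    using \<sigma>_nonzero by (simp add: \<eta>_def t_def field_simps)
  have "\<sigma>^2 * (\<sigma> * \<eta> * of_real c ^ 2 + (\<sigma> * \<eta> - 1) * of_real (k * (c - k) - k^2)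
      + \<sigma>^2 * of_real (k * (c - k) ^ 3))
      = \<sigma> * \<eta> * (t + b)^2 + (\<sigma> * \<eta> - 1) * (b * t - b^2) + b * t ^ 3"
    by (simp add: t_def b_def algebra_simps eval_nat_numeral)
  also have "\<dots> = \<sigma> * \<eta> * (1 - \<sigma> * \<eta>)^2"
    unfolding \<sigma>\<eta> b by (simp add: algebra_simps eval_nat_numeral)
  also have "\<dots> = \<sigma>^2 * (\<eta> / \<sigma> * (1 - \<sigma> * \<eta>)^2)"
    using \<sigma>_nonzero by (simp add: power2_eq_square)
  finally show ?thesis
    using \<sigma>_nonzero by (simp only: mult_cancel_left power_eq_0_iff) simp
qed

lemma deriv_N:
  "(N has_vector_derivative of_real (u1 x)
    - \<sigma> * (of_real (u1 x) * (\<eta> - of_real (u1 x)) + of_real (c - u x) * of_real (u x - m x)))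
    (at x)"
proof -
  have "((\<lambda>x. c - u x) has_real_derivative - u1 x) (at x)"
    by (auto intro!: derivative_eq_intros deriv_u)
  note w = has_vector_derivative_of_real[OF this, where 'a = complex]
  show ?thesis
    unfolding N_def
    by (rule has_vector_derivative_eq_rhs)
      (rule derivative_intros w deriv_u deriv_u1 | simp add: algebra_simps)+
qed

lemma deriv_D: "(D has_vector_derivative - 2 * \<sigma> * of_real (c - u x) * of_real (u1 x)) (at x)"
proof -
  have "((\<lambda>x. c - u x) has_real_derivative - u1 x) (at x)"
    by (auto intro!: derivative_eq_intros deriv_u)
  note w = has_vector_derivative_of_real[OF this, where 'a = complex]
  show ?thesis
    unfolding D_def power2_eq_square
    by (rule has_vector_derivative_eq_rhs)
      (rule derivative_intros w | simp add: algebra_simps)+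
qed

text \<open>This Riccati equation is equivalent to the characteristic equation.\<close>

lemma deriv_g:
  "(g has_vector_derivative
      - \<sigma> * of_real (c - u x) * g x - \<sigma> * (of_real (u1 x) - \<eta>) - (g x)^2) (at x)"
proof -
  define w U d M where defs: "w = complex_of_real (c - u x)" "U = complex_of_real (u x)"
    "d = complex_of_real (u1 x)" "M = complex_of_real (m x)"
  define C where "C = complex_of_real (k * (c - k) - k^2)"
  define N' where "N' = d - \<sigma> * (d * (\<eta> - d) + w * (U - M))"
  define D' where "D' = - 2 * \<sigma> * w * d"
  define A where "A = U + \<sigma> * \<eta> * w"
  have N: "N x = A - \<sigma> * w * d" and D: "D x = \<sigma> * w^2 + \<eta> - 1 / \<sigma>"
    by (simp_all add: N_def D_def A_def defs algebra_simps)
  have \<sigma>D: "\<sigma> * D x = \<sigma>^2 * w^2 + \<sigma> * \<eta> - 1"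
    using \<sigma>_nonzero by (simp add: D algebra_simps power2_eq_square)
  have "d^2 = of_real (u1 x ^ 2)" by (simp add: defs)
  then have d: "d^2 = U^2 - M * w + C"
    unfolding first_integral by (simp add: defs C_def)
  have "M * w ^ 3 = of_real (m x * (c - u x) ^ 3)" by (simp add: defs)
  then have K: "M * w ^ 3 = of_real (k * (c - k) ^ 3)"
    using m_eq[of x] by (simp add: mult.commute del: of_real_mult of_real_power)
  have U: "U = of_real c - w" by (simp add: defs)
  \<comment> \<open>This is the Riccati equation with denominators cleared. The terms linear in
    \<open>d\<close> cancel by \<open>\<sigma>D\<close>, the first integral removes
    \<open>d^2\<close>, and \<open>M\<close> survives only in the constant \<open>M * w ^ 3\<close>;
    what is left is the characteristic equation.\<close>
  have "N' * D x - N x * D' + (N x)^2 + \<sigma> * w * N x * D x + \<sigma> * (d - \<eta>) * (D x)^2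
      = (\<sigma> * D x - \<sigma>^2 * w^2) * d^2 + d * D x * (1 - \<sigma> * \<eta> - \<sigma>^2 * w^2 + \<sigma> * D x)
        + A^2 - \<sigma> * w * (U - M) * D x + \<sigma> * w * A * D x - \<sigma> * \<eta> * (D x)^2"
    by (simp add: N N'_def D'_def algebra_simps power2_eq_square)
  also have "\<dots> = (\<sigma> * \<eta> - 1) * d^2 + A^2 - \<sigma> * w * (U - M) * D x + \<sigma> * w * A * D x
      - \<sigma> * \<eta> * (D x)^2"
    by (simp add: \<sigma>D)
  also have "\<dots> = (\<sigma> * \<eta> - 1) * d^2 + A^2 + w * M * (\<sigma> * D x)
      + \<eta> * (\<sigma> * D x) * (\<sigma> * w^2) - \<eta> * (\<sigma> * D x) * D x"
    by (simp add: A_def algebra_simps power2_eq_square)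
  also have "\<dots> = \<sigma> * \<eta> * of_real c ^ 2 + (\<sigma> * \<eta> - 1) * C + \<sigma>^2 * (M * w ^ 3)
      - \<eta> / \<sigma> * (1 - \<sigma> * \<eta>)^2"
    unfolding d \<sigma>D A_def U D using \<sigma>_nonzero
    by (simp add: divide_simps) (simp add: algebra_simps power2_eq_square power3_eq_cube)
  also have "\<dots> = 0"
    using characteristic_equation by (simp add: K C_def)
  finally have "(N' * D x - N x * D') / (D x)^2
      = - \<sigma> * w * (N x / D x) - \<sigma> * (d - \<eta>) - (N x / D x)^2"
    using D_nonzero[of x]
    by (subst nonzero_divide_eq_eq)
      (simp_all add: left_diff_distrib power_divide, simp add: algebra_simps power2_eq_square)
  then show ?thesis
    using has_vector_derivative_quotient[OF deriv_N deriv_D D_nonzero, of x]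
    by (simp add: g_def[abs_def] N'_def D'_def defs)
qed

text \<open>The exponential of an antiderivative of \<open>g\<close> has no zeros. The Riccati
  equation identifies its second derivative with the one prescribed by the time equation, and the
  limits follow from that of \<open>g\<close>.\<close>

lemma exists_eigenfunction:
  obtains p p1 p2 :: "real \<Rightarrow> complex" where
    "\<And>x. p x \<noteq> 0"
    "\<And>x. (p has_vector_derivative p1 x) (at x)"
    "\<And>x. (p1 has_vector_derivative p2 x) (at x)"
    "\<And>x. (p2 has_vector_derivative p1 x + \<sigma> * of_real (m x) * p x) (at x)"
    "\<And>x. \<eta> * p x = p2 x / \<sigma> + of_real (c - u x) * p1 x + of_real (u1 x) * p x"
    "((\<lambda>x. p1 x / p x) \<longlongrightarrow> r) at_top"
    "((\<lambda>x. p2 x / p x) \<longlongrightarrow> r^2) at_top"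
proof -
  have "continuous_on UNIV g"
    using deriv_g by (auto simp: continuous_on_eq_continuous_at
        intro: has_vector_derivative_continuous)
  then obtain G where G: "\<And>x. (G has_vector_derivative g x) (at x)"
    using exists_antiderivative by blast
  define p where "p x = exp (G x)" for x
  define p1 where "p1 x = g x * p x" for x
  \<comment> \<open>The time equation solved for the second derivative, so \<open>T\<close> holds by
    construction.\<close>
  define p2 where
    "p2 x = - \<sigma> * (of_real (c - u x) * p1 x) - \<sigma> * ((of_real (u1 x) - \<eta>) * p x)" for x
  have p2_eq: "p2 = (\<lambda>x. - \<sigma> * (of_real (c - u x) * p1 x)
      - \<sigma> * ((of_real (u1 x) - \<eta>) * p x))"
    by (simp add: p2_def fun_eq_iff)
  have w: "((\<lambda>x. complex_of_real (c - u x)) has_vector_derivative of_real (- u1 x)) (at x)" for x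
    by (intro has_vector_derivative_of_real) (auto intro!: derivative_eq_intros deriv_u)
  have nz: "p x \<noteq> 0" for x by (simp add: p_def)
  have p: "(p has_vector_derivative p1 x) (at x)" for x
    using has_vector_derivative_exp[OF G] by (simp add: p_def[abs_def] p1_def)
  have p1: "(p1 has_vector_derivative p2 x) (at x)" for x
    unfolding p1_def[abs_def]
    by (rule has_vector_derivative_eq_rhs[OF has_vector_derivative_mult[OF deriv_g p]])
      (simp add: p2_def p1_def algebra_simps power2_eq_square)
  have d: "((\<lambda>x. complex_of_real (u1 x) - \<eta>) has_vector_derivative of_real (u x - m x)) (at x)" for x
    using has_vector_derivative_diff[OF has_vector_derivative_of_real[OF deriv_u1]
        has_vector_derivative_const[of \<eta>]] by simp
  have "(p2 has_vector_derivative
      - \<sigma> * (of_real (c - u x) * p2 x + of_real (- u1 x) * p1 x)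
      - \<sigma> * ((of_real (u1 x) - \<eta>) * p1 x + of_real (u x - m x) * p x)) (at x)" for x
    unfolding p2_eq
    by (rule has_vector_derivative_diff has_vector_derivative_mult_right
        has_vector_derivative_mult w p1[unfolded p2_eq] d p)+
  moreover have "- \<sigma> * (of_real (c - u x) * p2 x + of_real (- u1 x) * p1 x)
      - \<sigma> * ((of_real (u1 x) - \<eta>) * p1 x + of_real (u x - m x) * p x)
      = p1 x + \<sigma> * of_real (m x) * p x" for x
  proof -
    \<comment> \<open>The spatial equation amounts to the definition of \<open>g\<close> in the form
      \<open>g * D = N\<close>.\<close>
    have gD: "g x * (\<sigma> * D x) = \<sigma> * N x" using D_nonzero[of x] by (simp add: g_def)
    have \<sigma>D: "\<sigma> * D x = \<sigma>^2 * of_real (c - u x)^2 + \<sigma> * \<eta> - 1"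
      using \<sigma>_nonzero by (simp add: D_def algebra_simps power2_eq_square)
    have "- \<sigma> * (of_real (c - u x) * p2 x + of_real (- u1 x) * p1 x)
      - \<sigma> * ((of_real (u1 x) - \<eta>) * p1 x + of_real (u x - m x) * p x)
      - (p1 x + \<sigma> * of_real (m x) * p x)
      = (g x * (\<sigma>^2 * of_real (c - u x)^2 + \<sigma> * \<eta> - 1) - \<sigma> * N x) * p x"
      by (simp add: p2_def p1_def N_def algebra_simps power2_eq_square)
    also have "\<dots> = 0" using gD unfolding \<sigma>D by simp
    finally show ?thesis by simp
  qed
  ultimately have p2: "(p2 has_vector_derivative p1 x + \<sigma> * of_real (m x) * p x) (at x)" for x
    by metis
  have T: "\<eta> * p x = p2 x / \<sigma> + of_real (c - u x) * p1 x + of_real (u1 x) * p x" for x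
    using \<sigma>_nonzero by (simp add: p2_def field_simps)
  have lim1: "((\<lambda>x. p1 x / p x) \<longlongrightarrow> r) at_top"
    using lim_g nz by (simp add: p1_def)
  have "((\<lambda>x. - \<sigma> * (of_real (c - u x) * g x) - \<sigma> * (of_real (u1 x) - \<eta>))
      \<longlongrightarrow> - \<sigma> * (of_real (c - k) * r) - \<sigma> * (of_real 0 - \<eta>)) at_top"
    by (intro tendsto_intros lim_u lim_u1 lim_g)
  also have "- \<sigma> * (of_real (c - k) * r) - \<sigma> * (of_real 0 - \<eta>) = r^2"
    using \<sigma>_nonzero by (simp add: \<eta>_def field_simps)
  also have "(\<lambda>x. - \<sigma> * (of_real (c - u x) * g x) - \<sigma> * (of_real (u1 x) - \<eta>)) = (\<lambda>x. p2 x / p x)"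
    using nz by (simp add: p2_def p1_def fun_eq_iff field_simps)
  finally have lim2: "((\<lambda>x. p2 x / p x) \<longlongrightarrow> r^2) at_top" .
  show ?thesis
    by (rule that[OF nz p p1 p2 T lim1 lim2])
qed

section \<open>Squared eigenfunctions and their asymptotics\<close>

lemma s_root: "of_real k * \<sigma> = s ^ 3 - s"
proof -
  have "r ^ 3 - r - (s ^ 3 - s) = (r - s) * (r^2 + r * s + s^2 - 1)"
    by (simp add: algebra_simps eval_nat_numeral)
  then show ?thesis using r_root r_s by simp
qed

text \<open>The reflection of (\<sigma>, r, s) to (-\<sigma>, -s, -r) preserves all assumptions and
  \<mu>. The construction of eigenfunctions thereby yields the adjoint eigenfunction with exponent
  \<open>- s\<close>.\<close>

lemma adjoint: "dp_eigenfunction c k u u1 m (- \<sigma>) (- s) (- r) \<mu>"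
proof
  show "of_real k * - \<sigma> = (- s) ^ 3 - - s"
    using s_root by (simp add: eval_nat_numeral)
  show "(- s)^2 + - s * - r + (- r)^2 = 1"
    using r_s by (simp add: algebra_simps)
  show "\<mu> = ((- s)^2 - (- r)^2) / - \<sigma> + of_real (c - k) * (- s - - r)"
    using \<sigma>_nonzero by (simp add: \<mu>_eq field_simps)
qed (use \<sigma>_nonzero Re_\<mu> \<mu>_nonzero in auto)

text \<open>In a product of the two eigenfunctions the time eigenvalues add up to \<mu>. Division by
  \<open>e\<close>, the product of their spatial parts, turns \<open>v\<close>, \<open>v1\<close>
  and \<open>v2\<close> into polynomials in convergent quotients, with limits in the ratio 1 : z :
  z^2 for \<open>z = r - s\<close>.\<close>

lemma squared_eigenfunction_solution:
  obtains v v1 v2 e :: "real \<Rightarrow> complex" and \<phi> \<psi> where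
    "\<And>x. e x \<noteq> 0"
    "\<And>x. (v has_vector_derivative v1 x) (at x)"
    "\<And>x. (v1 has_vector_derivative v2 x) (at x)"
    "((\<lambda>x. v x / e x) \<longlongrightarrow> (r - s) * (1 + r * s)) at_top"
    "((\<lambda>x. v1 x / e x) \<longlongrightarrow> (r - s)^2 * (1 + r * s)) at_top"
    "((\<lambda>x. v2 x / e x) \<longlongrightarrow> (r - s)^3 * (1 + r * s)) at_top"
    "spectral_solution c u \<mu> v"
    "lax_solution c u \<sigma> \<phi>" "adjoint_lax_solution c u \<sigma> \<psi>"
    "\<And>\<xi> t. exp (\<mu> * of_real t) * v \<xi> = squared_eigenfunction \<phi> \<psi> \<xi> t"
proof -
  interpret adj: dp_eigenfunction c k u u1 m "- \<sigma>" "- s" "- r" \<mu>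
    by (rule adjoint)
  define \<zeta> where "\<zeta> = adj.\<eta>"
  have \<mu>: "\<mu> = \<eta> + \<zeta>"
    using \<sigma>_nonzero by (simp add: \<mu>_eq \<eta>_def \<zeta>_def adj.\<eta>_def field_simps)
  obtain p p1 p2 where p_nz: "\<And>x. p x \<noteq> 0"
    and p: "\<And>x. (p has_vector_derivative p1 x) (at x)"
    and p1: "\<And>x. (p1 has_vector_derivative p2 x) (at x)"
    and p2: "\<And>x. (p2 has_vector_derivative p1 x + \<sigma> * of_real (m x) * p x) (at x)"
    and Tp: "\<And>x. \<eta> * p x = p2 x / \<sigma> + of_real (c - u x) * p1 x + of_real (u1 x) * p x"
    and lim_p1: "((\<lambda>x. p1 x / p x) \<longlongrightarrow> r) at_top"
    and lim_p2: "((\<lambda>x. p2 x / p x) \<longlongrightarrow> r^2) at_top"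
    by (rule exists_eigenfunction) blast
  obtain q q1 q2 where q_nz: "\<And>x. q x \<noteq> 0"
    and q: "\<And>x. (q has_vector_derivative q1 x) (at x)"
    and q1: "\<And>x. (q1 has_vector_derivative q2 x) (at x)"
    and q2: "\<And>x. (q2 has_vector_derivative q1 x + - \<sigma> * of_real (m x) * q x) (at x)"
    and Tq: "\<And>x. \<zeta> * q x = q2 x / - \<sigma> + of_real (c - u x) * q1 x + of_real (u1 x) * q x"
    and lim_q1: "((\<lambda>x. q1 x / q x) \<longlongrightarrow> - s) at_top"
    and lim_q2: "((\<lambda>x. q2 x / q x) \<longlongrightarrow> (- s)^2) at_top"
    unfolding \<zeta>_def by (rule adj.exists_eigenfunction) blast

  define M M1 M2 where "M x = complex_of_real (m x)" and "M1 x = complex_of_real (m1 x)"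
    and "M2 x = complex_of_real (m2 x)" for x
  have dM: "(M has_vector_derivative M1 x) (at x)" "(M1 has_vector_derivative M2 x) (at x)" for x
    unfolding M_def[abs_def] M1_def[abs_def] M2_def
    by (rule has_vector_derivative_of_real deriv_m deriv_m1)+
  \<comment> \<open>\<open>y2\<close> is the Wronskian of \<open>p\<close> and \<open>q\<close>,
    with derivatives \<open>y1\<close> and \<open>z\<close>. The spatial equations show that
    \<open>h\<close>, with derivative \<open>h1\<close>, is v - v'' written without higher
    derivatives.\<close>
  define y1 y2 where "y1 x = p x * q2 x - p2 x * q x" and "y2 x = p x * q1 x - p1 x * q x" for x
  define z where "z x = p1 x * q2 x - p2 x * q1 x + y2 x - 2 * \<sigma> * M x * (p x * q x)" for x
  define h where "h x = \<sigma> * (3 * (M x * y1 x) + M1 x * y2 x)" for x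
  define h1 where "h1 x = \<sigma> * (3 * (M x * z x + M1 x * y1 x) + (M1 x * y1 x + M2 x * y2 x))" for x
  define V where "V x = p x * q x - p1 x * q1 x" for x
  define v where "v x = p1 x * q x + p x * q1 x - p2 x * q1 x - p1 x * q2 x" for x
  define v1 where
    "v1 x = p2 x * q x + p x * q2 x - 2 * (p2 x * q2 x) - \<sigma> * (M x * y2 x)" for x
  define v2 where "v2 x = v x - h x" for x
  define v3 where "v3 x = v1 x - h1 x" for x
  note mult = has_vector_derivative_mult and diff = has_vector_derivative_diff
    and add = has_vector_derivative_add
  note p2' = p2[folded M_def] and q2' = q2[folded M_def]
  have y2: "(y2 has_vector_derivative y1 x) (at x)" for x
    unfolding y2_def[abs_def]
    by (rule has_vector_derivative_eq_rhs[OF diff[OF mult[OF p q1] mult[OF p1 q]]])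
      (simp add: y1_def)
  have y1: "(y1 has_vector_derivative z x) (at x)" for x
    unfolding y1_def[abs_def]
    by (rule has_vector_derivative_eq_rhs[OF diff[OF mult[OF p q2'] mult[OF p2' q]]])
      (simp add: z_def y2_def algebra_simps)
  have h: "(h has_vector_derivative h1 x) (at x)" for x
    unfolding h_def[abs_def] h1_def
    by (rule has_vector_derivative_mult_right mult add dM y1 y2)+
  have V: "(V has_vector_derivative v x) (at x)" for x
    unfolding V_def[abs_def]
    by (rule has_vector_derivative_eq_rhs[OF diff[OF mult[OF p q] mult[OF p1 q1]]])
      (simp add: v_def algebra_simps)
  have v: "(v has_vector_derivative v1 x) (at x)" for x
    unfolding v_def[abs_def]
    by (rule has_vector_derivative_eq_rhs[OF diff[OF diff[OF add[OF mult[OF p1 q] mult[OF p q1]]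
              mult[OF p2' q1]] mult[OF p1 q2']]])
      (simp add: v1_def y2_def algebra_simps)
  have v1: "(v1 has_vector_derivative v2 x) (at x)" for x
    unfolding v1_def[abs_def]
    by (rule has_vector_derivative_eq_rhs[OF diff[OF diff[OF add[OF mult[OF p2' q] mult[OF p q2']]
              has_vector_derivative_mult_right[OF mult[OF p2' q2']]]
              has_vector_derivative_mult_right[OF mult[OF dM(1) y2]]]])
      (simp add: v2_def v_def h_def y1_def y2_def algebra_simps)
  have v2: "(v2 has_vector_derivative v3 x) (at x)" for x
    unfolding v2_def[abs_def] v3_def by (rule diff[OF v h])

  \<comment> \<open>The spectral equation in terms of \<open>h\<close>, with u'' replaced by u - m.
    It follows by letting the time flow act on \<open>y1\<close> and \<open>y2\<close> through the
    eigenvector relations of both factors; those of \<open>q\<close> carry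
    \<open>- \<sigma>\<close>.\<close>
  have spectral: "\<mu> * h x = of_real (c - u x) * h1 x - 3 * of_real (u1 x) * h x - 3 * M x * v1 x
      - M1 x * v x" for x
  proof -
    define w d U where "w = complex_of_real (c - u x)" and "d = complex_of_real (u1 x)"
      and "U = complex_of_real (u x)"
    have C: "complex_of_real c = w + U" by (simp add: w_def U_def)
    note P = time_flow_matrix[OF \<sigma>_nonzero p p1 p2 Tp, of x, folded M_def w_def d_def U_def,
        unfolded C]
    note Q = time_flow_matrix[OF adj.\<sigma>_nonzero q q1 q2 Tq, of x, folded M_def w_def d_def U_def,
        unfolded C]
    have "\<sigma> * \<mu> * y1 x = (\<sigma> * \<eta> * p x) * q2 x - p x * (- \<sigma> * \<zeta> * q2 x)
        - (\<sigma> * \<eta> * p2 x) * q x + p2 x * (- \<sigma> * \<zeta> * q x)"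
      by (simp add: \<mu> y1_def algebra_simps)
    also have "\<dots> = - v1 x - \<sigma> * M x * y2 x + \<sigma> * (w * z x + U * y2 x)"
      unfolding P Q by (simp add: v1_def z_def y2_def algebra_simps)
    finally have B1: "\<sigma> * \<mu> * y1 x = - v1 x - \<sigma> * M x * y2 x + \<sigma> * (w * z x + U * y2 x)" .
    have "\<sigma> * \<mu> * y2 x = (\<sigma> * \<eta> * p x) * q1 x - p x * (- \<sigma> * \<zeta> * q1 x)
        - (\<sigma> * \<eta> * p1 x) * q x + p1 x * (- \<sigma> * \<zeta> * q x)"
      by (simp add: \<mu> y2_def algebra_simps)
    also have "\<dots> = - v x + \<sigma> * (w * y1 x + d * y2 x)"
      unfolding P Q by (simp add: v_def y1_def y2_def algebra_simps)
    finally have B2: "\<sigma> * \<mu> * y2 x = - v x + \<sigma> * (w * y1 x + d * y2 x)" .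
    have "(c - u x) * m1 x = 3 * u1 x * m x" by (simp add: m1_def)
    then have wM1: "w * M1 x = 3 * d * M x"
      unfolding w_def M1_def d_def M_def
      by (metis of_real_mult of_real_numeral)
    have "(c - u x) * m2 x = 3 * (u x - m x) * m x + 4 * u1 x * m1 x" by (simp add: m2_def)
    then have wM2: "w * M2 x = 3 * (U - M x) * M x + 4 * d * M1 x"
      unfolding w_def M1_def d_def M_def M2_def U_def
      by (metis of_real_mult of_real_numeral of_real_add of_real_diff)
    have "\<mu> * h x = 3 * M x * (\<sigma> * \<mu> * y1 x) + M1 x * (\<sigma> * \<mu> * y2 x)"
      by (simp add: h_def algebra_simps)
    also have "\<dots> = \<sigma> * (3 * M x * (w * z x) + 4 * ((w * M1 x) * y1 x) + (w * M2 x) * y2 x)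
        - 3 * d * h x - 3 * M x * v1 x - M1 x * v x"
      unfolding B1 B2 wM1 wM2 h_def by (simp add: algebra_simps wM1)
    also have "\<dots> = w * h1 x - 3 * d * h x - 3 * M x * v1 x - M1 x * v x"
      by (simp add: h1_def algebra_simps)
    finally show ?thesis by (simp add: w_def d_def)
  qed
  have nd: "nderiv (Suc 0) v = v1" "nderiv 2 v = v2" "nderiv 3 v = v3"
    by (rule nderiv_1_eqI[OF v] nderiv_2_eqI[OF v v1] nderiv_3_eqI[OF v v1 v2])+
  have nh: "nderiv (Suc 0) (\<lambda>y. v y - v2 y) = h1"
    by (rule nderiv_1_eqI) (simp add: v2_def h)
  have sol: "spectral_solution c u \<mu> v"
    unfolding spectral_solution_def One_nat_def nd nh nderiv_u
  proof (intro conjI allI)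
    show "times_differentiable 3 v"
      by (rule times_differentiable_3I[OF v v1 v2])
    fix x
    have "\<mu> * (v x - v2 x) = \<mu> * h x" by (simp add: v2_def)
    also note spectral
    finally show "\<mu> * (v x - v2 x) = of_real c * h1 x + 3 * of_real (u1 x) * v2 x
        + 3 * of_real (u x - m x) * v1 x - 4 * of_real (u x) * v1 x - 4 * of_real (u1 x) * v x
        + of_real (u x) * v3 x + of_real (u1 x - m1 x) * v x"
      by (simp add: v2_def v3_def M_def M1_def algebra_simps)
  qed

  define e where "e x = p x * q x" for x
  have e_nz: "e x \<noteq> 0" for x using p_nz q_nz by (simp add: e_def)
  have lim_M: "(M \<longlongrightarrow> of_real k) at_top" "(M1 \<longlongrightarrow> of_real 0) at_top"
    unfolding M_def M1_def by (intro tendsto_of_real lim_m lim_m1)+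
  define a1 a2 b1 b2 where "a1 x = p1 x / p x" and "a2 x = p2 x / p x" and "b1 x = q1 x / q x"
    and "b2 x = q2 x / q x" for x
  have lims: "(a1 \<longlongrightarrow> r) at_top" "(a2 \<longlongrightarrow> r^2) at_top" "(b1 \<longlongrightarrow> - s) at_top"
    "(b2 \<longlongrightarrow> (- s)^2) at_top"
    using lim_p1 lim_p2 lim_q1 lim_q2 by (simp_all add: a1_def[abs_def] a2_def[abs_def]
        b1_def[abs_def] b2_def[abs_def])
  have ve: "v x / e x = a1 x + b1 x - a2 x * b1 x - a1 x * b2 x"
    and v1e: "v1 x / e x = a2 x + b2 x - 2 * (a2 x * b2 x) - \<sigma> * (M x * (b1 x - a1 x))"
    and he: "h x / e x = \<sigma> * (3 * (M x * (b2 x - a2 x)) + M1 x * (b1 x - a1 x))" for x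
    using p_nz[of x] q_nz[of x]
    by (simp_all add: v_def v1_def h_def y1_def y2_def e_def a1_def a2_def b1_def b2_def field_simps)
  have "((\<lambda>x. v x / e x) \<longlongrightarrow> r + - s - r^2 * - s - r * (- s)^2) at_top"
    unfolding ve by (intro tendsto_intros lims)
  also have "r + - s - r^2 * - s - r * (- s)^2 = (r - s) * (1 + r * s)"
    by (simp add: algebra_simps power2_eq_square)
  finally have lim_v: "((\<lambda>x. v x / e x) \<longlongrightarrow> (r - s) * (1 + r * s)) at_top" .
  have k\<sigma>: "2 * (of_real k * \<sigma>) = r ^ 3 - r + (s ^ 3 - s)"
    using r_root s_root by simp
  have one: "1 = r^2 + r * s + s^2" using r_s by simp
  \<comment> \<open>Vieta: the third root of x^3 - x = k\<sigma> is -(r + s), and the product of the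
    three roots is k\<sigma>.\<close>
  have k\<sigma>': "of_real k * \<sigma> = - (r * s * (r + s))"
  proof -
    have "2 * (of_real k * \<sigma>) = (r + s) * (r^2 - r * s + s^2 - 1)"
      unfolding k\<sigma> by (simp add: algebra_simps eval_nat_numeral)
    also have "\<dots> = 2 * - (r * s * (r + s))"
      by (subst one) (simp add: algebra_simps)
    finally show ?thesis by (simp only: mult_cancel_left) simp
  qed
  have "((\<lambda>x. v1 x / e x) \<longlongrightarrow> r^2 + (- s)^2 - 2 * (r^2 * (- s)^2)
      - \<sigma> * (of_real k * (- s - r))) at_top"
    unfolding v1e by (intro tendsto_intros lims lim_M)
  also have "r^2 + (- s)^2 - 2 * (r^2 * (- s)^2) - \<sigma> * (of_real k * (- s - r))
      = r^2 + s^2 - 2 * r^2 * s^2 + (of_real k * \<sigma>) * (r + s)"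
    by (simp add: algebra_simps)
  \<comment> \<open>The second summand is a multiple of \<open>1 - (r^2 + r * s + s^2)\<close>,
    which vanishes by \<open>r_s\<close>.\<close>
  also have "\<dots> = (r - s)^2 * (r^2 + r * s + s^2 + r * s)
      + (r^2 + s^2) * (1 - (r^2 + r * s + s^2))"
    unfolding k\<sigma>' by (simp add: algebra_simps eval_nat_numeral)
  also have "\<dots> = (r - s)^2 * (1 + r * s)" by (simp add: r_s)
  finally have lim_v1: "((\<lambda>x. v1 x / e x) \<longlongrightarrow> (r - s)^2 * (1 + r * s)) at_top" .
  have "((\<lambda>x. v x / e x - h x / e x) \<longlongrightarrow> (r - s) * (1 + r * s)
      - \<sigma> * (3 * (of_real k * ((- s)^2 - r^2)) + of_real 0 * (- s - r))) at_top"
    unfolding he by (intro tendsto_intros lims lim_M lim_v)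
  also have "(r - s) * (1 + r * s)
      - \<sigma> * (3 * (of_real k * ((- s)^2 - r^2)) + of_real 0 * (- s - r))
      = (r - s) * (1 + r * s) + 3 * (of_real k * \<sigma>) * (r - s) * (r + s)"
    by (simp add: algebra_simps power2_eq_square)
  also have "\<dots> = (r - s)^3 * (1 + r * s)
      + (r - s) * (1 + 4 * (r * s)) * (1 - (r^2 + r * s + s^2))"
    unfolding k\<sigma>' by (simp add: algebra_simps eval_nat_numeral)
  also have "\<dots> = (r - s)^3 * (1 + r * s)" by (simp add: r_s)
  also have "(\<lambda>x. v x / e x - h x / e x) = (\<lambda>x. v2 x / e x)"
    by (simp add: v2_def diff_divide_distrib)
  finally have lim_v2: "((\<lambda>x. v2 x / e x) \<longlongrightarrow> (r - s)^3 * (1 + r * s)) at_top" .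

  define \<phi> where "\<phi> \<xi> t = exp (\<eta> * of_real t) * p \<xi>" for \<xi> t :: real
  define \<psi> where "\<psi> \<xi> t = exp (\<zeta> * of_real t) * q \<xi>" for \<xi> t :: real
  have \<phi>: "lax_solution c u \<sigma> \<phi>"
    unfolding \<phi>_def[abs_def] by (rule separated_lax_solution[OF p p1 p2 Tp])
  have \<psi>: "adjoint_lax_solution c u \<sigma> \<psi>"
    unfolding \<psi>_def[abs_def] adjoint_lax_solution_iff
    by (rule separated_lax_solution[OF q q1 q2 Tq])
  have conn: "exp (\<mu> * of_real t) * v x = squared_eigenfunction \<phi> \<psi> x t" for x t
  proof -
    have dx\<phi>: "dx (Suc 0) \<phi> y t = exp (\<eta> * of_real t) * p1 y" for y
      unfolding dx_def \<phi>_def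
      by (subst nderiv_1_eqI[OF has_vector_derivative_mult_right[OF p]]) simp
    have dx\<psi>: "dx (Suc 0) \<psi> y t = exp (\<zeta> * of_real t) * q1 y" for y
      unfolding dx_def \<psi>_def
      by (subst nderiv_1_eqI[OF has_vector_derivative_mult_right[OF q]]) simp
    have "(\<lambda>y. \<phi> y t * \<psi> y t - dx (Suc 0) \<phi> y t * dx (Suc 0) \<psi> y t)
        = (\<lambda>y. exp (\<mu> * of_real t) * V y)"
      by (simp add: dx\<phi> dx\<psi> \<phi>_def \<psi>_def V_def \<mu> distrib_right exp_add algebra_simps)
    then show ?thesis
      unfolding squared_eigenfunction_def One_nat_def dx_def[of _ "\<lambda>\<xi> t. \<phi> \<xi> t * _ \<xi> t - _ \<xi> t"]
      by (simp add: nderiv_1_eqI[OF has_vector_derivative_mult_right[OF V]])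
  qed
  show ?thesis
    by (rule that[OF e_nz v v1 lim_v lim_v1 lim_v2 sol \<phi> \<psi> conn])
qed

end

section \<open>Exponents at infinity and the choice of the spectral parameter\<close>

context dp_profile
begin

text \<open>
  The exponents of the spectral equation at infinity are the roots \<open>z\<close> of the cubic below, which
  are the differences of two roots \<open>r = a + z / 2\<close> and \<open>s = a - z / 2\<close> of
  \<open>r ^ 3 - r = k * \<sigma>\<close>.
\<close>

definition exponent :: "complex \<Rightarrow> complex \<Rightarrow> bool" where
  "exponent \<mu> z \<longleftrightarrow>
    of_real (c - k) * z ^ 3 - \<mu> * z^2 - of_real (c - 4 * k) * z + \<mu> = 0"

text \<open>For real \<open>z\<close> the imaginary part of the cubic is
  \<open>Im \<mu> * (1 - z^2)\<close>, so \<open>z^2 = 1\<close>; the real part then reduces to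
  \<open>3 * k * z\<close>, which is nonzero.\<close>

lemma exponent_not_real:
  assumes "exponent \<mu> z" and "Re \<mu> = 0" and "\<mu> \<noteq> 0"
  shows "z \<notin> \<real>"
proof
  assume "z \<in> \<real>"
  then obtain x where x: "z = of_real x" by (auto elim: Reals_cases)
  have "Im \<mu> \<noteq> 0" using assms(2,3) by (simp add: complex_eq_iff)
  have eq: "of_real ((c - k) * x ^ 3 - (c - 4 * k) * x) + \<mu> * of_real (1 - x^2) = 0"
    using assms(1) by (simp add: exponent_def x algebra_simps)
  from arg_cong[OF eq, of Im] have "x^2 = 1"
    using \<open>Im \<mu> \<noteq> 0\<close> by simp
  from arg_cong[OF eq, of Re] have "(c - k) * x ^ 3 - (c - 4 * k) * x = 0"
    using \<open>Re \<mu> = 0\<close> by simp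
  moreover have "x ^ 3 = x"
    using \<open>x^2 = 1\<close> by (simp only: power3_eq_cube power2_eq_square)
  ultimately have "3 * k * x = 0" by (simp add: algebra_simps)
  then show False using \<open>x^2 = 1\<close> k_pos by auto
qed

text \<open>Eliminating \<mu> between the cubic and its derivative leaves a real quadratic in
  \<open>z^2\<close> whose discriminant is nonnegative. A double root would thus be real.\<close>

lemma exponent_simple:
  assumes z: "exponent \<mu> z" and "Re \<mu> = 0" and "\<mu> \<noteq> 0"
  shows "3 * of_real (c - k) * z^2 - 2 * \<mu> * z - of_real (c - 4 * k) \<noteq> 0"
proof
  assume deriv: "3 * of_real (c - k) * z^2 - 2 * \<mu> * z - of_real (c - 4 * k) = 0"
  define A B where "A = c - 4 * k" and "B = c - k"
  have AB: "0 < A" "A < B" using k_pos k_less by (simp_all add: A_def B_def)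
  have "of_real B * (z^2)^2 - of_real (3 * B - A) * z^2 + of_real A
      = - ((3 * of_real B * z^2 - 2 * \<mu> * z - of_real A) * (1 - z^2))
        - 2 * z * (of_real B * z ^ 3 - \<mu> * z^2 - of_real A * z + \<mu>)"
    by (simp add: algebra_simps eval_nat_numeral)
  also have "\<dots> = 0"
    using deriv z by (simp add: exponent_def A_def B_def)
  finally have root: "of_real B * (z^2)^2 - of_real (3 * B - A) * z^2 + of_real A = 0" .
  have "(3 * B - A)^2 - 4 * B * A = (B - A) * (9 * B - A)"
    by (simp add: algebra_simps power2_eq_square)
  also have "\<dots> \<ge> 0" using AB by simp
  finally have "z \<in> \<real>"
    using AB root by (intro real_if_square_root_of_real_quadratic[of B "3 * B - A" A]) auto
  then show False using exponent_not_real assms by blast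
qed

text \<open>The cubic has only simple roots, so over the complex numbers it has as many distinct
  roots as its degree.\<close>

lemma three_exponents:
  assumes "Re \<mu> = 0" and "\<mu> \<noteq> 0"
  obtains z1 z2 z3 where "exponent \<mu> z1" "exponent \<mu> z2" "exponent \<mu> z3"
    "z1 \<noteq> z2" "z1 \<noteq> z3" "z2 \<noteq> z3"
proof -
  define P where "P = [:\<mu>, - of_real (c - 4 * k), - \<mu>, complex_of_real (c - k):]"
  have P: "poly P z = 0 \<longleftrightarrow> exponent \<mu> z" for z
    by (simp add: P_def exponent_def algebra_simps eval_nat_numeral)
  have P': "poly (pderiv P) z = 3 * of_real (c - k) * z^2 - 2 * \<mu> * z - of_real (c - 4 * k)" for z
    by (simp add: P_def pderiv_pCons algebra_simps eval_nat_numeral)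
  have "of_real (c - k) \<noteq> (0 :: complex)"
    using k_less_c by simp
  then have deg: "degree P = 3" and "P \<noteq> 0"
    by (auto simp: P_def simp del: of_real_diff)
  have "rsquarefree P"
    unfolding rsquarefree_roots P P' using exponent_simple assms by blast
  then have "P = smult (lead_coeff P) (\<Prod>z | poly P z = 0. [:-z, 1:])"
    by (simp add: complex_poly_decompose_rsquarefree)
  then have "degree P = degree (\<Prod>z | poly P z = 0. [:-z, 1:])"
    using \<open>P \<noteq> 0\<close> by (metis degree_smult_eq leading_coeff_0_iff)
  also have "\<dots> = card {z. poly P z = 0}"
    by (subst degree_prod_eq_sum_degree) auto
  finally have "card {z. exponent \<mu> z} = 3" by (simp add: deg P)
  then show ?thesis using that unfolding card_3_iff by blast
qed

text \<open>Bundles a solution with its leading behaviour: relative to \<open>e\<close>, which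
  absorbs the growth, the vector (v, v', v'') tends to \<open>C\<close> times the Vandermonde column
  (1, z, z^2).\<close>

definition connected_solution ::
  "complex \<Rightarrow> complex \<Rightarrow> (real \<Rightarrow> complex) \<Rightarrow> (real \<Rightarrow> complex) \<Rightarrow> (real \<Rightarrow> complex)
    \<Rightarrow> (real \<Rightarrow> complex) \<Rightarrow> complex \<Rightarrow> bool" where
  "connected_solution \<mu> z v v1 v2 e C \<longleftrightarrow> C \<noteq> 0 \<and>
    (\<forall>x. e x \<noteq> 0 \<and> (v has_vector_derivative v1 x) (at x) \<and>
      (v1 has_vector_derivative v2 x) (at x)) \<and>
    ((\<lambda>x. v x / e x) \<longlongrightarrow> C) at_top \<and> ((\<lambda>x. v1 x / e x) \<longlongrightarrow> C * z) at_top \<and>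
    ((\<lambda>x. v2 x / e x) \<longlongrightarrow> C * z^2) at_top \<and>
    spectral_solution c u \<mu> v \<and>
    (\<exists>\<sigma> \<phi> \<psi>. \<sigma> \<noteq> 0 \<and> lax_solution c u \<sigma> \<phi> \<and> adjoint_lax_solution c u \<sigma> \<psi> \<and>
      (\<forall>\<xi> t. exp (\<mu> * of_real t) * v \<xi> = squared_eigenfunction \<phi> \<psi> \<xi> t))"

text \<open>With \<open>r\<close> and \<open>s\<close> centred at \<open>a\<close> and at distance
  \<open>z\<close>, the condition \<open>r_s\<close> determines \<open>a^2\<close>,
  \<open>r_root\<close> determines \<sigma>, and the cubic for \<open>z\<close> becomes
  \<open>\<mu>_eq\<close>. Since \<open>z\<close> is not real, it avoids 0, 1, -1, 2 and -2, which
  keeps \<sigma> and the amplitude \<open>C\<close> nonzero.\<close>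

lemma exists_connected_solution:
  assumes z: "exponent \<mu> z" and \<mu>: "Re \<mu> = 0" "\<mu> \<noteq> 0"
  shows "\<exists>v v1 v2 e C. connected_solution \<mu> z v v1 v2 e C"
proof -
  have nonreal: "z \<notin> \<real>" by (rule exponent_not_real[OF assms])
  have "z^2 \<noteq> 1" using nonreal by (metis Reals_1 Reals_minus power2_eq_1_iff)
  have "z^2 \<noteq> 4"
  proof
    assume "z^2 = 4"
    then have "z^2 = 2^2" by simp
    then have "z = 2 \<or> z = - 2" by (simp only: power2_eq_iff)
    then show False using nonreal by auto
  qed
  have "z \<noteq> 0" using nonreal by auto
  \<comment> \<open>Solves \<open>3 * a^2 + z^2 / 4 = 1\<close>, which is \<open>r_s\<close> in
    these coordinates.\<close>
  define a where "a = csqrt ((4 - z^2) / 12)"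
  have a: "a^2 = (4 - z^2) / 12" by (simp add: a_def)
  have "a \<noteq> 0" using \<open>z^2 \<noteq> 4\<close> by (auto simp: a_def)
  \<comment> \<open>Chosen so that \<open>k * \<sigma>\<close> equals
    \<open>r ^ 3 - r = 2 * a * (z^2 - 1) / 3\<close>.\<close>
  define \<sigma> where "\<sigma> = 2 * a * (z^2 - 1) / (3 * of_real k)"
  have "\<sigma> \<noteq> 0" using \<open>a \<noteq> 0\<close> \<open>z^2 \<noteq> 1\<close> k_pos by (simp add: \<sigma>_def)
  define r s where "r = a + z / 2" and "s = a - z / 2"
  have "1 + r * s = 1 + (a^2 - z^2 / 4)"
    by (simp add: r_def s_def field_simps power2_eq_square)
  also have "1 + (a^2 - z^2 / 4) = (4 - z^2) / 3"
    unfolding a by (simp add: field_simps)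
  finally have rs: "1 + r * s = (4 - z^2) / 3" .
  have r_s_diff: "r - s = z" by (simp add: r_def s_def)
  have cube: "a ^ 3 = a * ((4 - z^2) / 12)"
    by (simp only: a[symmetric]) (simp only: power3_eq_cube power2_eq_square mult.assoc)
  interpret dp_eigenfunction c k u u1 m \<sigma> r s \<mu>
  proof
    show "\<sigma> \<noteq> 0" "Re \<mu> = 0" "\<mu> \<noteq> 0" by fact+
    have "(a + y) ^ 3 = a ^ 3 + 3 * a^2 * y + 3 * a * y^2 + y ^ 3" for y
      by (simp add: algebra_simps eval_nat_numeral)
    then have "r ^ 3 - r = a ^ 3 + 3 * a^2 * (z / 2) + 3 * a * (z / 2)^2 + (z / 2) ^ 3 - a - z / 2"
      by (simp add: r_def)
    also have "\<dots> = 2 * a * (z^2 - 1) / 3"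
      unfolding cube a by (simp add: field_simps eval_nat_numeral)
    finally show "of_real k * \<sigma> = r ^ 3 - r"
      using k_pos by (simp add: \<sigma>_def)
    have "r^2 + r * s + s^2 = 3 * a^2 + z^2 / 4"
      by (simp add: r_def s_def field_simps power2_eq_square)
    then show "r^2 + r * s + s^2 = 1"
      unfolding a by (simp add: field_simps)
    have "(r^2 - s^2) / \<sigma> = 2 * a * z / \<sigma>"
      by (simp add: r_def s_def field_simps power2_eq_square)
    also have "\<dots> = 3 * of_real k * z / (z^2 - 1)"
      using \<open>a \<noteq> 0\<close> \<open>z^2 \<noteq> 1\<close> k_pos by (simp add: \<sigma>_def field_simps)
    finally have "(r^2 - s^2) / \<sigma> + of_real (c - k) * (r - s)
        = (3 * of_real k * z + of_real (c - k) * z * (z^2 - 1)) / (z^2 - 1)"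
      using \<open>z^2 \<noteq> 1\<close> by (simp add: r_s_diff field_simps)
    also have "3 * of_real k * z + of_real (c - k) * z * (z^2 - 1) = \<mu> * (z^2 - 1)"
      using z by (simp add: exponent_def algebra_simps eval_nat_numeral)
    finally show "\<mu> = (r^2 - s^2) / \<sigma> + of_real (c - k) * (r - s)"
      using \<open>z^2 \<noteq> 1\<close> by simp
  qed
  define C where "C = z * (1 + r * s)"
  have "C \<noteq> 0" using \<open>z \<noteq> 0\<close> \<open>z^2 \<noteq> 4\<close> by (simp add: C_def rs)
  obtain v v1 v2 e \<phi> \<psi> where *:
    "\<And>x. e x \<noteq> 0"
    "\<And>x. (v has_vector_derivative v1 x) (at x)"
    "\<And>x. (v1 has_vector_derivative v2 x) (at x)"
    "((\<lambda>x. v x / e x) \<longlongrightarrow> (r - s) * (1 + r * s)) at_top"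
    "((\<lambda>x. v1 x / e x) \<longlongrightarrow> (r - s)^2 * (1 + r * s)) at_top"
    "((\<lambda>x. v2 x / e x) \<longlongrightarrow> (r - s)^3 * (1 + r * s)) at_top"
    "spectral_solution c u \<mu> v"
    "lax_solution c u \<sigma> \<phi>" "adjoint_lax_solution c u \<sigma> \<psi>"
    "\<And>\<xi> t. exp (\<mu> * of_real t) * v \<xi> = squared_eigenfunction \<phi> \<psi> \<xi> t"
    by (rule squared_eigenfunction_solution) blast
  have C: "(r - s) * (1 + r * s) = C" "(r - s)^2 * (1 + r * s) = C * z"
    "(r - s)^3 * (1 + r * s) = C * z^2"
    by (simp_all add: r_s_diff C_def eval_nat_numeral algebra_simps)
  show ?thesis
    unfolding connected_solution_def
    by (intro exI[of _ v] exI[of _ v1] exI[of _ v2] exI[of _ e] exI[of _ C] conjI allI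
        exI[of _ \<sigma>] exI[of _ \<phi>] exI[of _ \<psi>] \<open>C \<noteq> 0\<close> \<open>\<sigma> \<noteq> 0\<close> *[unfolded C])
qed

end

section \<open>Linear independence from distinct exponents\<close>

text \<open>A vanishing combination and its first two derivatives form a linear system at each
  point. After scaling the columns by \<open>e\<close>, its determinant tends to a nonzero multiple
  of a Vandermonde determinant, so the system is regular at some point.\<close>

lemma lin_indep_family_if_exponents_distinct:
  fixes v v1 v2 e :: "nat \<Rightarrow> real \<Rightarrow> complex" and C z :: "nat \<Rightarrow> complex"
  assumes nz: "\<And>j x. j \<in> {1, 2, 3} \<Longrightarrow> e j x \<noteq> 0" "\<And>j. j \<in> {1, 2, 3} \<Longrightarrow> C j \<noteq> 0"
    and deriv: "\<And>j x. j \<in> {1, 2, 3} \<Longrightarrow> (v j has_vector_derivative v1 j x) (at x)"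
      "\<And>j x. j \<in> {1, 2, 3} \<Longrightarrow> (v1 j has_vector_derivative v2 j x) (at x)"
    and lim: "\<And>j. j \<in> {1, 2, 3} \<Longrightarrow> ((\<lambda>x. v j x / e j x) \<longlongrightarrow> C j) at_top"
      "\<And>j. j \<in> {1, 2, 3} \<Longrightarrow> ((\<lambda>x. v1 j x / e j x) \<longlongrightarrow> C j * z j) at_top"
      "\<And>j. j \<in> {1, 2, 3} \<Longrightarrow> ((\<lambda>x. v2 j x / e j x) \<longlongrightarrow> C j * z j ^ 2) at_top"
    and distinct: "z 1 \<noteq> z 2" "z 1 \<noteq> z 3" "z 2 \<noteq> z 3"
  shows "lin_indep_family {1, 2, 3} v"
  unfolding lin_indep_family_def
proof (intro allI impI)
  fix a :: "nat \<Rightarrow> complex"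
  assume "\<forall>\<xi>. (\<Sum>j\<in>{1, 2, 3}. a j * v j \<xi>) = 0"
  then have 0: "(\<lambda>x. \<Sum>j\<in>{1, 2, 3}. a j * v j x) = (\<lambda>x. 0)" by auto
  have "((\<lambda>x. \<Sum>j\<in>{1, 2, 3}. a j * v j x) has_vector_derivative
      (\<Sum>j\<in>{1, 2, 3}. a j * v1 j x)) (at x)" for x
    by (intro has_vector_derivative_sum has_vector_derivative_mult_right deriv)
  then have 1: "(\<Sum>j\<in>{1, 2, 3}. a j * v1 j x) = 0" for x
    unfolding 0 using vector_derivative_unique_at has_vector_derivative_const by blast
  then have 1: "(\<lambda>x. \<Sum>j\<in>{1, 2, 3}. a j * v1 j x) = (\<lambda>x. 0)" by auto
  have "((\<lambda>x. \<Sum>j\<in>{1, 2, 3}. a j * v1 j x) has_vector_derivative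
      (\<Sum>j\<in>{1, 2, 3}. a j * v2 j x)) (at x)" for x
    by (intro has_vector_derivative_sum has_vector_derivative_mult_right deriv)
  then have 2: "(\<Sum>j\<in>{1, 2, 3}. a j * v2 j x) = 0" for x
    unfolding 1 using vector_derivative_unique_at has_vector_derivative_const by blast
  define R0 R1 R2 where "R0 j x = v j x / e j x" and "R1 j x = v1 j x / e j x"
    and "R2 j x = v2 j x / e j x" for j x
  define det where "det x = R0 1 x * (R1 2 x * R2 3 x - R1 3 x * R2 2 x)
    - R0 2 x * (R1 1 x * R2 3 x - R1 3 x * R2 1 x)
    + R0 3 x * (R1 1 x * R2 2 x - R1 2 x * R2 1 x)" for x
  define L where "L = C 1 * (C 2 * z 2 * (C 3 * z 3 ^ 2) - C 3 * z 3 * (C 2 * z 2 ^ 2))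
    - C 2 * (C 1 * z 1 * (C 3 * z 3 ^ 2) - C 3 * z 3 * (C 1 * z 1 ^ 2))
    + C 3 * (C 1 * z 1 * (C 2 * z 2 ^ 2) - C 2 * z 2 * (C 1 * z 1 ^ 2))"
  have "(det \<longlongrightarrow> L) at_top"
    unfolding det_def R0_def R1_def R2_def L_def by (intro tendsto_intros lim) auto
  moreover have "L = C 1 * C 2 * C 3 * ((z 2 - z 1) * (z 3 - z 1) * (z 3 - z 2))"
    by (simp add: L_def algebra_simps power2_eq_square)
  then have "L \<noteq> 0" using distinct nz(2) by simp
  ultimately have "\<forall>\<^sub>F x in at_top. det x \<noteq> 0"
    by (rule tendsto_imp_eventually_ne)
  then obtain x where det: "det x \<noteq> 0"
    using eventually_happens'[OF trivial_limit_at_top_linorder] by blast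
  \<comment> \<open>Scaling the columns by \<open>1 / e j x\<close> multiplies the unknowns by
    \<open>e j x\<close>.\<close>
  define b where "b j = a j * e j x" for j
  have b0: "b 1 * R0 1 x + b 2 * R0 2 x + b 3 * R0 3 x = 0"
    using nz(1)[of _ x] fun_cong[OF 0, of x] by (simp add: b_def R0_def add.assoc)
  have b1: "b 1 * R1 1 x + b 2 * R1 2 x + b 3 * R1 3 x = 0"
    using nz(1)[of _ x] fun_cong[OF 1, of x] by (simp add: b_def R1_def add.assoc)
  have b2: "b 1 * R2 1 x + b 2 * R2 2 x + b 3 * R2 3 x = 0"
    using nz(1)[of _ x] 2[of x] by (simp add: b_def R2_def add.assoc)
  \<comment> \<open>Cramer's rule: the cofactors of each column isolate one unknown.\<close>
  have "det x * b 1 = (b 1 * R0 1 x + b 2 * R0 2 x + b 3 * R0 3 x) * (R1 2 x * R2 3 x - R1 3 x * R2 2 x)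
    - (b 1 * R1 1 x + b 2 * R1 2 x + b 3 * R1 3 x) * (R0 2 x * R2 3 x - R0 3 x * R2 2 x)
    + (b 1 * R2 1 x + b 2 * R2 2 x + b 3 * R2 3 x) * (R0 2 x * R1 3 x - R0 3 x * R1 2 x)"
    by (simp add: det_def algebra_simps)
  then have "b 1 = 0" using det unfolding b0 b1 b2 by simp
  have "det x * b 2 = - (b 1 * R0 1 x + b 2 * R0 2 x + b 3 * R0 3 x) * (R1 1 x * R2 3 x - R1 3 x * R2 1 x)
    + (b 1 * R1 1 x + b 2 * R1 2 x + b 3 * R1 3 x) * (R0 1 x * R2 3 x - R0 3 x * R2 1 x)
    - (b 1 * R2 1 x + b 2 * R2 2 x + b 3 * R2 3 x) * (R0 1 x * R1 3 x - R0 3 x * R1 1 x)"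
    by (simp add: det_def algebra_simps)
  then have "b 2 = 0" using det unfolding b0 b1 b2 by simp
  have "det x * b 3 = (b 1 * R0 1 x + b 2 * R0 2 x + b 3 * R0 3 x) * (R1 1 x * R2 2 x - R1 2 x * R2 1 x)
    - (b 1 * R1 1 x + b 2 * R1 2 x + b 3 * R1 3 x) * (R0 1 x * R2 2 x - R0 2 x * R2 1 x)
    + (b 1 * R2 1 x + b 2 * R2 2 x + b 3 * R2 3 x) * (R0 1 x * R1 2 x - R0 2 x * R1 1 x)"
    by (simp add: det_def algebra_simps)
  then have "b 3 = 0" using det unfolding b0 b1 b2 by simp
  show "\<forall>j\<in>{1, 2, 3}. a j = 0"
    using \<open>b 1 = 0\<close> \<open>b 2 = 0\<close> \<open>b 3 = 0\<close> nz(1)[of _ x] by (auto simp: b_def)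
qed

section \<open>Application to the solitary wave\<close>

lemma solitary_profile_imp_dp_profile:
  assumes "0 < k" and "k < c / 4" and u: "solitary_profile k c u"
  shows "dp_profile c k u (nderiv 1 u) (momentum u)"
proof
  have deriv: "(nderiv n u has_real_derivative nderiv (Suc n) u x) (at x)" for n x
    unfolding has_real_derivative_iff_has_vector_derivative
    using u by (intro smooth_has_vector_derivative) (simp add: solitary_profile_def)
  show "(u has_real_derivative nderiv 1 u x) (at x)" for x
    using deriv[of 0] by simp
  show "(nderiv 1 u has_real_derivative u x - momentum u x) (at x)" for x
    using deriv[of 1] by (simp add: momentum_def numeral_2_eq_2)
  show "(u \<longlongrightarrow> k) at_top"
    using u at_top_le_at_infinity by (auto simp: solitary_profile_def intro: tendsto_mono)
qed (use assms in \<open>auto simp: solitary_profile_def\<close>)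

theorem proposition4p8:
  fixes c k :: real and u\<^sub>0 :: "real \<Rightarrow> real" and \<mu> :: complex
  assumes "c > 0" and "0 < k" and "k < c / 4"
    and "solitary_profile k c u\<^sub>0"
    and "Re \<mu> = 0" and "\<mu> \<noteq> 0"
  shows "\<exists>v :: nat \<Rightarrow> real \<Rightarrow> complex.
           lin_indep_family {1, 2, 3} v \<and>
           (\<forall>j\<in>{1, 2, 3}.
              spectral_solution c u\<^sub>0 \<mu> (v j) \<and>
              (\<exists>\<sigma> \<phi> \<psi>. \<sigma> \<noteq> 0 \<and>
                 lax_solution c u\<^sub>0 \<sigma> \<phi> \<and> adjoint_lax_solution c u\<^sub>0 \<sigma> \<psi> \<and>
                 (\<forall>\<xi> t. exp (\<mu> * of_real t) * v j \<xi> = squared_eigenfunction \<phi> \<psi> \<xi> t)))"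
proof -
  interpret dp_profile c k u\<^sub>0 "nderiv 1 u\<^sub>0" "momentum u\<^sub>0"
    by (rule solitary_profile_imp_dp_profile) fact+
  obtain z1 z2 z3 where roots: "exponent \<mu> z1" "exponent \<mu> z2" "exponent \<mu> z3"
    and distinct: "z1 \<noteq> z2" "z1 \<noteq> z3" "z2 \<noteq> z3"
    using three_exponents[OF assms(5,6)] .
  \<comment> \<open>Every index other than 1 and 2 gets \<open>z3\<close>, so
    \<open>exponent\<close> holds for all natural numbers and solutions can be chosen for all of
    them at once.\<close>
  define z where "z j = (if j = 1 then z1 else if j = 2 then z2 else z3)" for j :: nat
  have "exponent \<mu> (z j)" for j using roots by (simp add: z_def)
  then have "\<exists>v v1 v2 e C. connected_solution \<mu> (z j) v v1 v2 e C" for j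
    by (intro exists_connected_solution assms)
  then obtain v v1 v2 e C where "\<And>j. connected_solution \<mu> (z j) (v j) (v1 j) (v2 j) (e j) (C j)"
    by metis
  note sol = this[unfolded connected_solution_def]
  have "lin_indep_family {1, 2, 3} v"
    by (rule lin_indep_family_if_exponents_distinct[of e C v v1 v2 z])
      (use sol distinct in \<open>simp_all add: z_def\<close>)
  then show ?thesis using sol by blast
qed

end
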